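(* Let $p$ be a prime and $q=1/p$. For integers $n\ge 1$ and $\mu\ge 1$, let $Q(n,p^\mu)$ denote the probability that a random symmetric $n\times n$ matrix $A$ over $\mathbf{Z}_{p^\mu}$ satisfies $\det(A)\equiv 0 \pmod{p^\mu}$. Let $k=\lfloor n/2\rfloor$ and $s=\lfloor(\mu-1)/2\rfloor$. Then $$Q(n,p^\mu)=\frac{q^\mu(1-q^n)-R}{1-q},$$ where $$R=q^{s+1}\sum_{j=0}^{k-1}\Big(q^\mu(1-q^n)-q^{2s+2}(1-q^{2j+1})\Big)\,q^{2j}\,\frac{\Pi_{2j}(q)\,\Pi_{j+s}(q^2)}{\Pi_j(q^2)^2\,\Pi_s(q^2)},$$ and $0\le R<q^{3\mu/2}$.
   Context: For a positive integer $m$, $\mathbf{Z}_m=\{1,2,\ldots,m\}$ (viewed as residues mod $m$). A random symmetric $n\times n$ matrix over $\mathbf{Z}_m$ is one whose entries $a_{ij}$, $i\le j$, are chosen independently and uniformly from $\mathbf{Z}_m$, with $a_{ji}=a_{ij}$. For $n\ge 0$, $\Pi_n(q)=\prod_{j=1}^n(1-q^j)$ (so $\Pi_0=1$). *)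

theory Defs
  imports "HOL-Analysis.Analysis" "HOL-Combinatorics.Combinatorics"
begin

definition Pi_q :: "nat \<Rightarrow> real \<Rightarrow> real" where
  "Pi_q n q = (\<Prod>j=1..n. 1 - q ^ j)"

text \<open>Symmetric n x n matrices with entries residues mod m, represented by
  representatives in {0..<m} (indices 0..<n); entries outside the index range are 0.
  Such a matrix is uniquely determined by its independent entries a_ij, i <= j,
  so the uniform distribution on this finite set is the random symmetric matrix.\<close>
definition sym_mats :: "nat \<Rightarrow> nat \<Rightarrow> (nat \<Rightarrow> nat \<Rightarrow> int) set" where
  "sym_mats n m = {A. (\<forall>i j. A i j = A j i)
                    \<and> (\<forall>i j. i < n \<and> j < n \<longrightarrow> A i j \<in> {0..<int m})
                    \<and> (\<forall>i j. \<not>(i < n \<and> j < n) \<longrightarrow> A i j = 0)}"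

definition det_n :: "nat \<Rightarrow> (nat \<Rightarrow> nat \<Rightarrow> int) \<Rightarrow> int" where
  "det_n n A = (\<Sum>\<sigma> | \<sigma> permutes {0..<n}. sign \<sigma> * (\<Prod>i<n. A i (\<sigma> i)))"

definition Q_prob :: "nat \<Rightarrow> nat \<Rightarrow> real" where
  "Q_prob n m = real (card {A \<in> sym_mats n m. int m dvd det_n n A}) / real (card (sym_mats n m))"

end

theory Submission
  imports Defs "HOL-Number_Theory.Cong"
begin

text \<open>
  Let \<open>G(r, m, \<mu>)\<close> be the probability that \<open>p^\<mu>\<close> divides the determinant of a random symmetric matrix of
  size \<open>r + m\<close> of which \<open>r\<close> rows (and columns) are multiples of \<open>p\<close>. Symmetric elimination on one of the
  other \<open>m\<close> rows leaves a Schur complement that is again uniformly distributed, so that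
  \<open>G(r, m) = (1 - q) G(r, m-1) + q (1 - q^(m-1)) G(r, m-2) + q^m G(r+1, m-1)\<close>, while
  \<open>G(r, 0, \<mu>) = G(0, r, \<mu> - r)\<close> on dividing by \<open>p\<close>. The numbers \<open>P(m, j)\<close> of the corank distribution over
  the field with \<open>p\<close> elements obey the same recurrence in \<open>m\<close>, hence the theorem amounts to the fixed
  point equation \<open>Q(n, \<mu>) = \<Sum>j. P(n, j) Q(j, \<mu> - j)\<close> for the claimed values \<open>Q\<close>. For the generating
  functions \<open>Z_n\<close> of the valuation of the determinant it reads \<open>Z_n = \<Sum>j. P(n, j) x^j Z_j\<close>. These are
  products, \<open>Z_(2k) = O_k (1 - q^(2k+1) x) V_k / (1 - q x)\<close> and \<open>Z_(2k+1) = O_(k+1) V_k / (1 - q x)\<close> with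
  \<open>O_k = \<Prod>i<k. 1 - q^(2i+1)\<close> and \<open>1 / V_k = \<Prod>i=1..k. 1 - q^(2i+1) x\<^sup>2\<close>, and the terms \<open>j = 2k\<close>,
  \<open>j = 2k+1\<close> combine so that the equation becomes a case of the \<open>q\<close>-Vandermonde identity. The sum in \<open>R\<close>
  telescopes at the level of generating functions.
\<close>

section \<open>Determinants over finite index sets\<close>

definition det_on :: "'a set \<Rightarrow> ('a \<Rightarrow> 'a \<Rightarrow> int) \<Rightarrow> int" where
  "det_on I A = (\<Sum>\<sigma> | \<sigma> permutes I. sign \<sigma> * (\<Prod>i\<in>I. A i (\<sigma> i)))"

lemma det_n_eq_det_on: "det_n n A = det_on {0..<n} A"
  by (simp add: det_n_def det_on_def atLeast0LessThan)

lemma det_on_empty [simp]: "det_on {} A = 1"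
proof -
  have "{\<sigma>::'a \<Rightarrow> 'a. \<sigma> permutes {}} = {id}" by (auto simp: permutes_empty)
  then show ?thesis by (simp add: det_on_def)
qed

lemma det_on_cong:
  assumes "\<And>i j. i \<in> I \<Longrightarrow> j \<in> I \<Longrightarrow> A i j = B i j"
  shows "det_on I A = det_on I B"
  unfolding det_on_def using assms
  by (intro sum.cong refl arg_cong2[where f = "(*)"] prod.cong) (auto simp: permutes_in_image)

lemma det_on_cong_mod:
  assumes "\<And>i j. i \<in> I \<Longrightarrow> j \<in> I \<Longrightarrow> [A i j = B i j] (mod m)"
  shows "[det_on I A = det_on I B] (mod m)"
  unfolding det_on_def using assms
  by (intro cong_sum cong_mult cong_refl cong_prod) (auto simp: permutes_in_image)

lemma det_on_scale:
  "det_on I (\<lambda>i j. c * A i j) = c ^ card I * det_on I A"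
  by (simp add: det_on_def prod.distrib sum_distrib_left algebra_simps)

lemma det_on_swap_columns:
  assumes I: "finite I" "a \<in> I" "b \<in> I" "a \<noteq> b"
  shows "det_on I (\<lambda>i j. A i (Transposition.transpose a b j)) = - det_on I A"
proof -
  let ?t = "Transposition.transpose a b"
  have t: "?t permutes I" using I by (simp add: permutes_swap_id)
  have "det_on I A = (\<Sum>\<sigma> | \<sigma> permutes I. sign (?t \<circ> \<sigma>) * (\<Prod>i\<in>I. A i ((?t \<circ> \<sigma>) i)))"
    unfolding det_on_def by (rule setum_permutations_compose_left[OF t])
  also have "\<dots> = (\<Sum>\<sigma> | \<sigma> permutes I. - (sign \<sigma> * (\<Prod>i\<in>I. A i (?t (\<sigma> i)))))"
  proof (rule sum.cong)
    fix \<sigma> assume "\<sigma> \<in> {\<sigma>. \<sigma> permutes I}"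
    then have "permutation \<sigma>" "permutation ?t"
      using I t by (auto simp: permutation_permutes)
    then have "sign (?t \<circ> \<sigma>) = - sign \<sigma>"
      using I by (simp add: sign_compose sign_swap_id)
    then show "sign (?t \<circ> \<sigma>) * (\<Prod>i\<in>I. A i ((?t \<circ> \<sigma>) i))
        = - (sign \<sigma> * (\<Prod>i\<in>I. A i (?t (\<sigma> i))))" by simp
  qed simp
  finally show ?thesis by (simp add: det_on_def sum_negf)
qed

text \<open>Precomposing every permutation with the transposition of \<open>a\<close> and
  \<open>b\<close> flips its sign and keeps its product, so the determinant equals its own
  negative.\<close>

lemma det_on_equal_rows:
  assumes I: "finite I" "a \<in> I" "b \<in> I" "a \<noteq> b" and eq: "\<And>j. j \<in> I \<Longrightarrow> A a j = A b j"
  shows "det_on I A = 0"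
proof -
  let ?t = "Transposition.transpose a b"
  have t: "?t permutes I" using I by (simp add: permutes_swap_id)
  have "det_on I A = (\<Sum>\<sigma> | \<sigma> permutes I. sign (\<sigma> \<circ> ?t) * (\<Prod>i\<in>I. A i ((\<sigma> \<circ> ?t) i)))"
    unfolding det_on_def by (rule sum_permutations_compose_right[OF t])
  also have "\<dots> = (\<Sum>\<sigma> | \<sigma> permutes I. - (sign \<sigma> * (\<Prod>i\<in>I. A i (\<sigma> i))))"
  proof (rule sum.cong)
    fix \<sigma> assume "\<sigma> \<in> {\<sigma>. \<sigma> permutes I}"
    then have \<sigma>: "\<sigma> permutes I" and "permutation \<sigma>" "permutation ?t"
      using I t by (auto simp: permutation_permutes)
    then have sgn: "sign (\<sigma> \<circ> ?t) = - sign \<sigma>"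
      using I by (simp add: sign_compose sign_swap_id)
    have "(\<Prod>i\<in>I. A i ((\<sigma> \<circ> ?t) i)) = (\<Prod>i\<in>I. A (?t i) ((\<sigma> \<circ> ?t) i))"
      using \<sigma> I eq by (intro prod.cong) (auto simp: Transposition.transpose_def permutes_in_image)
    also have "\<dots> = (\<Prod>i\<in>I. A i (\<sigma> i))"
      using prod.permute[OF t, of "\<lambda>i. A i (\<sigma> i)"] by (simp add: o_def)
    finally show "sign (\<sigma> \<circ> ?t) * (\<Prod>i\<in>I. A i ((\<sigma> \<circ> ?t) i))
        = - (sign \<sigma> * (\<Prod>i\<in>I. A i (\<sigma> i)))" using sgn by simp
  qed simp
  finally show ?thesis by (simp add: det_on_def sum_negf)
qed

lemma det_on_row_linear:
  assumes "finite I" "a \<in> I"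
  shows "det_on I (A(a := \<lambda>j. v j + c * w j)) = det_on I (A(a := v)) + c * det_on I (A(a := w))"
proof -
  have split: "(\<Prod>i\<in>I. (A(a := u)) i (\<sigma> i)) = u (\<sigma> a) * (\<Prod>i\<in>I - {a}. A i (\<sigma> i))" for u \<sigma>
    using assms by (subst prod.remove[of _ a]) auto
  show ?thesis
    unfolding det_on_def split by (simp add: sum_distrib_left sum.distrib[symmetric] algebra_simps)
qed

lemma det_on_add_row:
  assumes "finite I" "a \<in> I" "b \<in> I" "a \<noteq> b"
  shows "det_on I (A(a := \<lambda>j. A a j + c * A b j)) = det_on I A"
proof -
  have "det_on I (A(a := A b)) = 0"
    using assms by (intro det_on_equal_rows[of I a b]) auto
  then show ?thesis using assms by (simp add: det_on_row_linear)
qed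

lemma det_on_add_rows:
  assumes "finite K" "finite I" "K \<subseteq> I - {b}" "b \<in> I"
  shows "det_on I (\<lambda>i j. if i \<in> K then A i j + c i * A b j else A i j) = det_on I A"
  using assms
proof (induction K)
  case (insert a K)
  let ?B = "\<lambda>i j. if i \<in> K then A i j + c i * A b j else A i j"
  have "(\<lambda>i j. if i \<in> insert a K then A i j + c i * A b j else A i j)
      = ?B(a := \<lambda>j. ?B a j + c a * ?B b j)"
    using insert by (intro ext) auto
  then show ?case using insert det_on_add_row[of I a b ?B "c a"] by auto
qed simp

text \<open>A permutation that moves \<open>a\<close> meets column \<open>a\<close> in some other
  row, where the entry is zero; only the permutations of \<open>I - {a}\<close> contribute.\<close>

lemma det_on_expand_column:
  assumes "finite I" "a \<in> I" and zero: "\<And>i. i \<in> I - {a} \<Longrightarrow> A i a = 0"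
  shows "det_on I A = A a a * det_on (I - {a}) A"
proof -
  have "det_on I A = (\<Sum>\<sigma> | \<sigma> permutes I - {a}. sign \<sigma> * (\<Prod>i\<in>I. A i (\<sigma> i)))"
    unfolding det_on_def
  proof (rule sum.mono_neutral_right)
    show "finite {\<sigma>. \<sigma> permutes I}" using assms by (simp add: finite_permutations)
    show "{\<sigma>. \<sigma> permutes I - {a}} \<subseteq> {\<sigma>. \<sigma> permutes I}"
      using permutes_subset[of _ "I - {a}" I] by blast
    show "\<forall>\<sigma>\<in>{\<sigma>. \<sigma> permutes I} - {\<sigma>. \<sigma> permutes I - {a}}. sign \<sigma> * (\<Prod>i\<in>I. A i (\<sigma> i)) = 0"
    proof
      fix \<sigma> assume "\<sigma> \<in> {\<sigma>. \<sigma> permutes I} - {\<sigma>. \<sigma> permutes I - {a}}"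
      then have \<sigma>: "\<sigma> permutes I" and "\<not> \<sigma> permutes I - {a}" by auto
      have "\<sigma> permutes I - {a}" if "\<sigma> a = a"
        by (rule permutes_superset[OF \<sigma>]) (use that in auto)
      with \<open>\<not> \<sigma> permutes I - {a}\<close> have "\<sigma> a \<noteq> a" by blast
      obtain b where b: "b \<in> I" "\<sigma> b = a"
        using assms(2) permutes_image[OF \<sigma>] by (metis imageE)
      with \<open>\<sigma> a \<noteq> a\<close> have "b \<noteq> a" by metis
      then have "A b (\<sigma> b) = 0" using zero[of b] b by simp
      then have "(\<Prod>i\<in>I. A i (\<sigma> i)) = 0" using b assms(1) by (intro prod_zero) auto
      then show "sign \<sigma> * (\<Prod>i\<in>I. A i (\<sigma> i)) = 0" by simp
    qed
  qed
  also have "\<dots> = (\<Sum>\<sigma> | \<sigma> permutes I - {a}. A a a * (sign \<sigma> * (\<Prod>i\<in>I - {a}. A i (\<sigma> i))))"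
  proof (rule sum.cong)
    fix \<sigma> assume "\<sigma> \<in> {\<sigma>. \<sigma> permutes I - {a}}"
    then have "\<sigma> a = a" by (simp add: permutes_not_in)
    then show "sign \<sigma> * (\<Prod>i\<in>I. A i (\<sigma> i)) = A a a * (sign \<sigma> * (\<Prod>i\<in>I - {a}. A i (\<sigma> i)))"
      using assms by (subst prod.remove[of _ a]) auto
  qed simp
  finally show ?thesis by (simp add: det_on_def sum_distrib_left)
qed

text \<open>Subtracting multiples of row \<open>a\<close> clears its column, with \<open>d\<close>
  standing in for the inverse of the pivot; what remains is the Schur complement modulo
  \<open>m\<close>.\<close>

lemma det_on_pivot:
  assumes "finite I" "a \<in> I" and d: "[A a a * d = 1] (mod m)"
  shows "[det_on I A = A a a * det_on (I - {a}) (\<lambda>i j. A i j - d * A i a * A a j)] (mod m)"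
proof -
  define B where "B = (\<lambda>i j. if i \<in> I - {a} then A i j + (- d * A i a) * A a j else A i j)"
  \<comment> \<open>Elimination makes the rest of column \<open>a\<close> zero only modulo
    \<open>m\<close>. \<open>C\<close> puts exact zeros there, so that
    \<open>det_on_expand_column\<close> applies.\<close>
  define C where "C = (\<lambda>i j. if i \<noteq> a \<and> j = a then 0 else B i j)"
  have "[A i a + - d * A i a * A a a = 0] (mod m)" for i
  proof -
    have "[A i a - A i a * (A a a * d) = A i a - A i a * 1] (mod m)"
      by (intro cong_diff cong_mult cong_refl d)
    moreover have "A i a + - d * A i a * A a a = A i a - A i a * (A a a * d)"
      by (simp add: algebra_simps)
    ultimately show ?thesis by (simp only: mult_1_right diff_self)
  qed
  then have BC: "[B i j = C i j] (mod m)" if "i \<in> I" for i j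
    using that by (cases "i \<noteq> a \<and> j = a") (auto simp: B_def C_def)
  have "det_on I A = det_on I B"
    unfolding B_def by (rule det_on_add_rows[symmetric]) (use assms(1,2) in simp_all)
  moreover have "[det_on I B = det_on I C] (mod m)"
    using BC by (rule det_on_cong_mod)
  moreover have "det_on I C = C a a * det_on (I - {a}) C"
    by (rule det_on_expand_column) (use assms(1,2) in \<open>simp_all add: C_def\<close>)
  moreover have "C a a = A a a" by (simp add: B_def C_def)
  moreover have "det_on (I - {a}) C = det_on (I - {a}) (\<lambda>i j. A i j - d * A i a * A a j)"
    by (rule det_on_cong) (simp add: B_def C_def)
  ultimately show ?thesis by (simp only:)
qed

text \<open>The pivot block is \<open>[[x, u], [u, y]]\<close> with \<open>u\<close> and \<open>u - d x y\<close> units; swapping the two pivot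
  columns reduces the elimination to two scalar pivots.\<close>
lemma det_on_double_pivot:
  assumes I: "finite I" "a \<in> I" "b \<in> I" "a \<noteq> b"
    and sym: "\<And>i j. A i j = A j i"
    and d: "[A a b * d = 1] (mod m)"
    and e: "[(A a b - d * A a a * A b b) * e = 1] (mod m)"
  shows "[det_on I A = - (A a b * (A a b - d * A a a * A b b)) * det_on (I - {a} - {b})
      (\<lambda>i j. A i j - e * (A i b * A a j + A i a * A b j)
         + e * d * (A a a * A i b * A b j + A b b * A i a * A a j))] (mod m)"
proof -
  define u where "u = A a b"
  define w where "w = u - d * A a a * A b b"
  define B where "B = (\<lambda>i j. A i (Transposition.transpose a b j))"
  define C where "C = (\<lambda>i j. B i j - d * B i a * B a j)"
  define D where "D = (\<lambda>i j. C i j - e * C i b * C b j)"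
  define E where "E = (\<lambda>i j. A i j - e * (A i b * A a j + A i a * A b j)
         + e * d * (A a a * A i b * A b j + A b b * A i a * A a j))"
  have Baa: "B a a = u" by (simp add: B_def u_def)
  have Cbb: "C b b = w" using sym[of a b] by (simp add: C_def B_def w_def u_def algebra_simps)
  have d': "[u * d = 1] (mod m)" and e': "[w * e = 1] (mod m)"
    using d e by (simp_all only: w_def u_def)
  have 1: "det_on I A = - det_on I B"
    unfolding B_def using det_on_swap_columns[OF I, of A] by simp
  have 2: "[det_on I B = u * det_on (I - {a}) C] (mod m)"
    using det_on_pivot[OF I(1,2), of B d m] d' unfolding Baa C_def by simp
  have 3: "[det_on (I - {a}) C = w * det_on (I - {a} - {b}) D] (mod m)"
    using det_on_pivot[of "I - {a}" b C e m] e' I unfolding Cbb D_def by simp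
  \<comment> \<open>The two scalar pivots give \<open>A i b * A a j\<close> the coefficient
    \<open>d + e * (d * d * A a a * A b b)\<close>, but the mirrored product
    \<open>A i a * A b j\<close> the coefficient \<open>e\<close>. Both agree modulo
    \<open>m\<close>, which makes the final block symmetric.\<close>
  have "[d * (w * e) = d * 1] (mod m)" using e' by (intro cong_mult cong_refl)
  then have "[d * (w * e) + e * (d * d * A a a * A b b) = d * 1 + e * (d * d * A a a * A b b)] (mod m)"
    by (intro cong_add cong_refl)
  moreover have "d * (w * e) + e * (d * d * A a a * A b b) = e * (u * d)"
    by (simp add: w_def algebra_simps)
  moreover have "[e * (u * d) = e * 1] (mod m)" using d' by (intro cong_mult cong_refl)
  ultimately have de: "[d + e * (d * d * A a a * A b b) = e] (mod m)"
    by (metis cong_sym cong_trans mult_1_right)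
  have 4: "[det_on (I - {a} - {b}) D = det_on (I - {a} - {b}) E] (mod m)"
  proof (rule det_on_cong_mod)
    fix i j assume ij: "i \<in> I - {a} - {b}" "j \<in> I - {a} - {b}"
    define r where "r = A i j - e * (A i a * A b j)
        + e * d * (A a a * A i b * A b j + A b b * A i a * A a j)"
    have "D i j = r - (d + e * (d * d * A a a * A b b)) * (A i b * A a j)"
      using ij by (auto simp: D_def C_def B_def r_def algebra_simps)
    moreover have "E i j = r - e * (A i b * A a j)"
      by (simp add: E_def r_def algebra_simps)
    ultimately show "[D i j = E i j] (mod m)"
      using de by (simp only:) (intro cong_diff cong_mult cong_refl)
  qed
  have "[u * det_on (I - {a}) C = u * (w * det_on (I - {a} - {b}) E)] (mod m)"
    by (intro cong_mult cong_refl cong_trans[OF 3]) (rule 4)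
  then have "[- det_on I B = - (u * (w * det_on (I - {a} - {b}) E))] (mod m)"
    using 2 by (metis cong_minus_minus_iff cong_trans)
  then show ?thesis unfolding 1 by (simp add: w_def u_def E_def mult.assoc)
qed

section \<open>Counting symmetric matrices over residues\<close>

definition residue_entries :: "nat \<Rightarrow> nat \<Rightarrow> bool \<Rightarrow> int set" where
  "residue_entries p L b = {x. 0 \<le> x \<and> x < int p ^ L \<and> (b \<longrightarrow> int p dvd x)}"

definition res_rows :: "nat \<Rightarrow> nat \<Rightarrow> 'a set \<Rightarrow> 'a set \<Rightarrow> ('a \<Rightarrow> int) set" where
  "res_rows p L S I = {v. \<forall>k. (k \<in> I \<longrightarrow> v k \<in> residue_entries p L (k \<in> S)) \<and> (k \<notin> I \<longrightarrow> v k = 0)}"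

text \<open>\<open>S\<close> collects the indices whose rows and columns are divisible by \<open>p\<close>. Working with an arbitrary
  index set \<open>I\<close> instead of \<open>{0..<n}\<close> makes it possible to delete rows without renumbering.\<close>
definition res_mats :: "nat \<Rightarrow> nat \<Rightarrow> 'a set \<Rightarrow> 'a set \<Rightarrow> ('a \<Rightarrow> 'a \<Rightarrow> int) set" where
  "res_mats p L S I = {A. (\<forall>i j. A i j = A j i)
     \<and> (\<forall>i\<in>I. \<forall>j\<in>I. A i j \<in> residue_entries p L (i \<in> S \<or> j \<in> S))
     \<and> (\<forall>i j. \<not> (i \<in> I \<and> j \<in> I) \<longrightarrow> A i j = 0)}"

text \<open>The precision \<open>L\<close> of the entries is kept apart from the exponent
  \<open>\<mu>\<close> tested on the determinant: dividing a matrix by \<open>p\<close> lowers the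
  first by one, but the second by the size of the matrix.\<close>

definition singular_mats :: "nat \<Rightarrow> nat \<Rightarrow> nat \<Rightarrow> 'a set \<Rightarrow> 'a set \<Rightarrow> ('a \<Rightarrow> 'a \<Rightarrow> int) set" where
  "singular_mats p L \<mu> S I = {A \<in> res_mats p L S I. int p ^ \<mu> dvd det_on I A}"

definition border :: "'a \<Rightarrow> ('a \<Rightarrow> int) \<Rightarrow> ('a \<Rightarrow> 'a \<Rightarrow> int) \<Rightarrow> 'a \<Rightarrow> 'a \<Rightarrow> int" where
  "border i v B = (\<lambda>j k. if j = i then v k else if k = i then v j else B j k)"

lemma finite_residue_entries [simp]: "finite (residue_entries p L b)"
  by (rule finite_subset[of _ "{0..<int p ^ L}"]) (auto simp: residue_entries_def)

lemma residue_entries_multiples: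
  assumes "p > 0" "L > 0"
  shows "residue_entries p L True = (\<lambda>x. int p * x) ` {0..<int p ^ (L - 1)}"
proof -
  have L: "int p ^ L = int p * int p ^ (L - 1)" using assms by (cases L) auto
  have "x \<in> residue_entries p L True \<longleftrightarrow> (\<exists>y. x = int p * y \<and> 0 \<le> y \<and> y < int p ^ (L - 1))" for x
  proof
    assume x: "x \<in> residue_entries p L True"
    then obtain y where y: "x = int p * y" by (auto simp: residue_entries_def)
    from x have "0 \<le> int p * y" "int p * y < int p * int p ^ (L - 1)"
      by (simp_all add: residue_entries_def L y)
    with assms y show "\<exists>y. x = int p * y \<and> 0 \<le> y \<and> y < int p ^ (L - 1)"
      by (intro exI[of _ y]) (simp add: zero_le_mult_iff)
  next
    assume "\<exists>y. x = int p * y \<and> 0 \<le> y \<and> y < int p ^ (L - 1)"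
    with assms show "x \<in> residue_entries p L True"
      by (auto simp: residue_entries_def L)
  qed
  then show ?thesis by (auto simp: image_iff Bex_def)
qed

lemma card_residue_entries:
  assumes "p > 0" "L > 0"
  shows "real (card (residue_entries p L b)) = (if b then 1 / real p else 1) * real p ^ L"
proof (cases b)
  case True
  have "card (residue_entries p L True) = p ^ (L - 1)"
    unfolding residue_entries_multiples[OF assms]
    using assms by (subst card_image) (auto simp: inj_on_def nat_power_eq)
  with True assms show ?thesis by (cases L) auto
next
  case False
  have "residue_entries p L False = {0..<int p ^ L}" by (auto simp: residue_entries_def)
  with False show ?thesis by (simp add: nat_power_eq)
qed

lemma finite_res_rows [simp]: "finite I \<Longrightarrow> finite (res_rows p L S I)"
proof -
  assume "finite I"
  then have "finite {v. \<forall>k. (k \<in> I \<longrightarrow> v k \<in> {0..<int p ^ L}) \<and> (k \<notin> I \<longrightarrow> v k = 0)}"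
    by (intro finite_set_of_finite_funs) auto
  then show ?thesis
    by (rule finite_subset[rotated]) (auto simp: res_rows_def residue_entries_def)
qed

lemma finite_res_mats [simp]: "finite I \<Longrightarrow> finite (res_mats p L S I)"
proof -
  assume "finite I"
  then have "finite {f. \<forall>x. (x \<in> I \<times> I \<longrightarrow> f x \<in> {0..<int p ^ L}) \<and> (x \<notin> I \<times> I \<longrightarrow> f x = 0)}"
    (is "finite ?F") by (intro finite_set_of_finite_funs) auto
  moreover have "res_mats p L S I \<subseteq> curry ` ?F"
  proof
    fix A assume "A \<in> res_mats p L S I"
    then have "case_prod A \<in> ?F" by (auto simp: res_mats_def residue_entries_def)
    moreover have "A = curry (case_prod A)" by simp
    ultimately show "A \<in> curry ` ?F" by blast
  qed
  ultimately show ?thesis using finite_subset by blast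
qed

lemma finite_singular_mats [simp]: "finite I \<Longrightarrow> finite (singular_mats p L \<mu> S I)"
  by (simp add: singular_mats_def)

lemma card_res_rows:
  assumes "p > 0" "L > 0" "finite I" "S \<subseteq> I"
  shows "real (card (res_rows p L S I)) = (1 / real p) ^ card S * real p ^ (L * card I)"
proof -
  have "bij_betw (\<lambda>v. restrict v I) (res_rows p L S I) (Pi\<^sub>E I (\<lambda>k. residue_entries p L (k \<in> S)))"
    by (rule bij_betw_byWitness[where f' = "\<lambda>v k. if k \<in> I then v k else 0"])
       (auto simp: res_rows_def fun_eq_iff PiE_def extensional_def)
  then have "card (res_rows p L S I) = (\<Prod>k\<in>I. card (residue_entries p L (k \<in> S)))"
    using assms by (simp add: bij_betw_same_card card_PiE)
  then have "real (card (res_rows p L S I))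
      = (\<Prod>k\<in>I. (if k \<in> S then 1 / real p else 1) * real p ^ L)"
    using assms by (simp add: card_residue_entries)
  also have "\<dots> = (\<Prod>k\<in>I. if k \<in> S then 1 / real p else 1) * real p ^ (L * card I)"
    by (simp add: prod.distrib power_mult)
  also have "(\<Prod>k\<in>I. if k \<in> S then 1 / real p else 1) = (\<Prod>k\<in>I \<inter> S. 1 / real p)"
    using assms(3) by (simp only: prod.inter_restrict)
  also have "\<dots> = (1 / real p) ^ card S" using assms by (simp add: Int_absorb1)
  finally show ?thesis .
qed

lemma res_rows_mono: "S \<subseteq> T \<Longrightarrow> res_rows p L T I \<subseteq> res_rows p L S I"
  by (fastforce simp: res_rows_def residue_entries_def)

text \<open>A symmetric matrix is its row \<open>i\<close> together with what is left on deleting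
  row and column \<open>i\<close>, and the two vary independently. Because
  \<open>i \<notin> S\<close>, the constraint on entry \<open>k\<close> of row \<open>i\<close>
  depends on \<open>k\<close> alone.\<close>

lemma card_res_mats_fibres:
  assumes "finite I" "i \<in> I" "i \<notin> S"
  shows "card {A \<in> res_mats p L S I. P A}
    = (\<Sum>v\<in>res_rows p L S I. card {B \<in> res_mats p L S (I - {i}). P (border i v B)})"
proof -
  let ?T = "SIGMA v:res_rows p L S I. {B \<in> res_mats p L S (I - {i}). P (border i v B)}"
  have "bij_betw (\<lambda>(v, B). border i v B) ?T {A \<in> res_mats p L S I. P A}"
  proof (rule bij_betw_byWitness[where f' = "\<lambda>A. (A i, \<lambda>j k. if j = i \<or> k = i then 0 else A j k)"])
    show "\<forall>x\<in>?T. (\<lambda>A. (A i, \<lambda>j k. if j = i \<or> k = i then 0 else A j k)) (case x of (v, B) \<Rightarrow> border i v B) = x"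
      by (auto simp: border_def res_mats_def fun_eq_iff)
    have border: "border i (A i) (\<lambda>j k. if j = i \<or> k = i then 0 else A j k) = A"
      if "\<And>j k. A j k = A k j" for A :: "'a \<Rightarrow> 'a \<Rightarrow> int"
      using that by (auto simp: border_def fun_eq_iff)
    then show "\<forall>A\<in>{A \<in> res_mats p L S I. P A}.
        (case (A i, \<lambda>j k. if j = i \<or> k = i then 0 else A j k) of (v, B) \<Rightarrow> border i v B) = A"
      by (auto simp: res_mats_def)
    show "(\<lambda>(v, B). border i v B) ` ?T \<subseteq> {A \<in> res_mats p L S I. P A}"
      using assms(2,3) by (auto simp: border_def res_mats_def res_rows_def)
    show "(\<lambda>A. (A i, \<lambda>j k. if j = i \<or> k = i then 0 else A j k)) ` {A \<in> res_mats p L S I. P A} \<subseteq> ?T"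
    proof safe
      fix A assume A: "A \<in> res_mats p L S I" and "P A"
      then show "P (border i (A i) (\<lambda>j k. if j = i \<or> k = i then 0 else A j k))"
        using border[of A] by (auto simp: res_mats_def)
      show "A i \<in> res_rows p L S I" using A assms(2,3) by (auto simp: res_mats_def res_rows_def)
      show "(\<lambda>j k. if j = i \<or> k = i then 0 else A j k) \<in> res_mats p L S (I - {i})"
        using A by (auto simp: res_mats_def)
    qed
  qed
  then have "card {A \<in> res_mats p L S I. P A} = card ?T" by (simp add: bij_betw_same_card)
  also have "\<dots> = (\<Sum>v\<in>res_rows p L S I. card {B \<in> res_mats p L S (I - {i}). P (border i v B)})"
    using assms(1) by (intro card_SigmaI) auto
  finally show ?thesis .
qed

lemma card_res_mats_remove:
  assumes "finite I" "i \<in> I" "i \<notin> S"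
  shows "card (res_mats p L S I) = card (res_rows p L S I) * card (res_mats p L S (I - {i}))"
  using card_res_mats_fibres[OF assms, of p L "\<lambda>_. True"] by simp

section \<open>Schur complements of random matrices\<close>

text \<open>Translation by \<open>C\<close> permutes the matrices modulo \<open>p^L\<close> and
  respects the divisibility imposed by \<open>S\<close>. This is the sense in which a Schur
  complement is again uniformly distributed.\<close>

lemma card_singular_shift:
  assumes "p > 0" "\<mu> \<le> L" "L > 0"
    and sym: "\<And>j k. C j k = C k j"
    and dvd: "\<And>j k. j \<in> I \<Longrightarrow> k \<in> I \<Longrightarrow> j \<in> S \<or> k \<in> S \<Longrightarrow> int p dvd C j k"
  shows "card {B \<in> res_mats p L S I. int p ^ \<mu> dvd det_on I (\<lambda>j k. B j k + C j k)}
    = card (singular_mats p L \<mu> S I)"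
proof -
  define f where "f = (\<lambda>C (B :: 'a \<Rightarrow> 'a \<Rightarrow> int) j k. if j \<in> I \<and> k \<in> I then (B j k + C j k) mod int p ^ L else 0)"
  \<comment> \<open>As \<open>p\<close> divides \<open>p^L\<close>, reduction modulo
    \<open>p^L\<close> keeps multiples of \<open>p\<close>.\<close>
  have pL: "int p dvd int p ^ L" and pos: "int p ^ L > 0" using assms by auto
  have f_in: "f C B \<in> res_mats p L S I"
    if B: "B \<in> res_mats p L S I" and "\<And>j k. C j k = C k j"
      and "\<And>j k. j \<in> I \<Longrightarrow> k \<in> I \<Longrightarrow> j \<in> S \<or> k \<in> S \<Longrightarrow> int p dvd C j k" for B C
    using that pos pL
    by (auto simp: f_def res_mats_def residue_entries_def dvd_mod_iff)
  have f_inv: "f (\<lambda>j k. - C j k) (f C B) = B" if "B \<in> res_mats p L S I" for B C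
  proof (intro ext)
    fix j k
    show "f (\<lambda>j k. - C j k) (f C B) j k = B j k"
    proof (cases "j \<in> I \<and> k \<in> I")
      case True
      have "((B j k + C j k) mod int p ^ L + - C j k) mod int p ^ L = B j k mod int p ^ L"
        by (simp add: mod_simps)
      then show ?thesis using True that by (auto simp: f_def res_mats_def residue_entries_def)
    next
      case False
      then show ?thesis using that by (auto simp: f_def res_mats_def)
    qed
  qed
  have det: "int p ^ \<mu> dvd det_on I (f C B) \<longleftrightarrow> int p ^ \<mu> dvd det_on I (\<lambda>j k. B j k + C j k)" for B C
  proof (rule cong_dvd_iff)
    have "[det_on I (f C B) = det_on I (\<lambda>j k. B j k + C j k)] (mod int p ^ L)"
      by (rule det_on_cong_mod) (simp add: f_def cong_def)
    then show "[det_on I (f C B) = det_on I (\<lambda>j k. B j k + C j k)] (mod int p ^ \<mu>)"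
      by (rule cong_dvd_modulus) (use assms in \<open>simp add: le_imp_power_dvd\<close>)
  qed
  have "bij_betw (f C) {B \<in> res_mats p L S I. int p ^ \<mu> dvd det_on I (\<lambda>j k. B j k + C j k)}
          (singular_mats p L \<mu> S I)"
  proof (rule bij_betw_byWitness[where f' = "f (\<lambda>j k. - C j k)"])
    show "\<forall>B\<in>{B \<in> res_mats p L S I. int p ^ \<mu> dvd det_on I (\<lambda>j k. B j k + C j k)}.
        f (\<lambda>j k. - C j k) (f C B) = B" using f_inv by auto
    show "\<forall>B\<in>singular_mats p L \<mu> S I. f C (f (\<lambda>j k. - C j k) B) = B"
      using f_inv[of _ "\<lambda>j k. - C j k"] by (auto simp: singular_mats_def)
    show "f C ` {B \<in> res_mats p L S I. int p ^ \<mu> dvd det_on I (\<lambda>j k. B j k + C j k)}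
        \<subseteq> singular_mats p L \<mu> S I"
      using f_in sym dvd by (auto simp: singular_mats_def det)
    have "int p ^ \<mu> dvd det_on I (\<lambda>j k. f (\<lambda>j k. - C j k) B j k + C j k)"
      if B: "B \<in> singular_mats p L \<mu> S I" for B
      using det[of C "f (\<lambda>j k. - C j k) B"] f_inv[of B "\<lambda>j k. - C j k"] B
      by (simp add: singular_mats_def)
    moreover have "f (\<lambda>j k. - C j k) B \<in> res_mats p L S I"
      if "B \<in> singular_mats p L \<mu> S I" for B
      using that sym dvd by (intro f_in) (auto simp: singular_mats_def)
    ultimately show "f (\<lambda>j k. - C j k) ` singular_mats p L \<mu> S I
        \<subseteq> {B \<in> res_mats p L S I. int p ^ \<mu> dvd det_on I (\<lambda>j k. B j k + C j k)}" by auto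
  qed
  then show ?thesis by (rule bij_betw_same_card)
qed

lemma prime_power_dvd_cong_unit:
  fixes x y z :: int
  assumes "prime p" "\<mu> \<le> L" "[x = y * z] (mod int p ^ L)" "\<not> int p dvd y"
  shows "int p ^ \<mu> dvd x \<longleftrightarrow> int p ^ \<mu> dvd z"
proof -
  have "[x = y * z] (mod int p ^ \<mu>)"
    by (rule cong_dvd_modulus[OF assms(3)]) (use assms in \<open>simp add: le_imp_power_dvd\<close>)
  then have "int p ^ \<mu> dvd x \<longleftrightarrow> int p ^ \<mu> dvd y * z" by (rule cong_dvd_iff)
  also have "coprime (int p ^ \<mu>) y"
    using assms by (simp add: prime_imp_coprime)
  then have "int p ^ \<mu> dvd y * z \<longleftrightarrow> int p ^ \<mu> dvd z" by (rule coprime_dvd_mult_right_iff)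
  finally show ?thesis .
qed

lemma prime_power_inverse:
  fixes x :: int
  assumes "prime p" "\<not> int p dvd x"
  obtains d where "[x * d = 1] (mod int p ^ L)"
proof -
  have "coprime (int p) x" using assms by (simp add: prime_imp_coprime)
  then have "coprime x (int p ^ L)" by (simp add: coprime_commute)
  then show ?thesis using that cong_solve_coprime_int by blast
qed

text \<open>Eliminating with the unit \<open>v i\<close> translates the remaining matrix by a matrix
  \<open>C\<close> that depends on \<open>v\<close> alone, so \<open>card_singular_shift\<close>
  gives the same count for every such row.\<close>

lemma card_singular_unit_pivot:
  assumes p: "prime p" and L: "\<mu> \<le> L" "L > 0" and I: "finite I" "i \<in> I"
    and v: "v \<in> res_rows p L S I" "\<not> int p dvd v i"
  shows "card {B \<in> res_mats p L S (I - {i}). int p ^ \<mu> dvd det_on I (border i v B)}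
    = card (singular_mats p L \<mu> S (I - {i}))"
proof -
  obtain d where d: "[v i * d = 1] (mod int p ^ L)" using prime_power_inverse p v(2) by blast
  define C where "C = (\<lambda>j k. - (d * v j * v k))"
  have det: "int p ^ \<mu> dvd det_on I (border i v B) \<longleftrightarrow>
      int p ^ \<mu> dvd det_on (I - {i}) (\<lambda>j k. B j k + C j k)" for B
  proof -
    define A where "A = border i v B"
    have at: "A i i = v i" by (simp add: A_def border_def)
    have "[det_on I A = A i i * det_on (I - {i}) (\<lambda>j k. A j k - d * A j i * A i k)] (mod int p ^ L)"
      using d unfolding at[symmetric] by (rule det_on_pivot[OF I])
    moreover have "det_on (I - {i}) (\<lambda>j k. A j k - d * A j i * A i k)
        = det_on (I - {i}) (\<lambda>j k. B j k + C j k)"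
      by (rule det_on_cong) (simp add: A_def C_def border_def)
    ultimately have "[det_on I A = v i * det_on (I - {i}) (\<lambda>j k. B j k + C j k)] (mod int p ^ L)"
      by (simp only: at)
    then show ?thesis unfolding A_def by (rule prime_power_dvd_cong_unit[OF p L(1) _ v(2)])
  qed
  have C_sym: "C j k = C k j" for j k by (simp add: C_def)
  have C_dvd: "int p dvd C j k" if "j \<in> I - {i}" "k \<in> I - {i}" "j \<in> S \<or> k \<in> S" for j k
    using that v(1) by (auto simp: C_def res_rows_def residue_entries_def)
  have "card {B \<in> res_mats p L S (I - {i}). int p ^ \<mu> dvd det_on I (border i v B)}
      = card {B \<in> res_mats p L S (I - {i}). int p ^ \<mu> dvd det_on (I - {i}) (\<lambda>j k. B j k + C j k)}"
    by (intro arg_cong[where f = card] Collect_cong conj_cong refl det)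
  also have "\<dots> = card (singular_mats p L \<mu> S (I - {i}))"
    using prime_gt_0_nat[OF p] L C_sym C_dvd by (rule card_singular_shift)
  finally show ?thesis .
qed

text \<open>Modulo \<open>p\<close> the block on \<open>i\<close> and \<open>j\<close> has
  determinant \<open>- (v j)^2\<close>, a unit whatever \<open>w j\<close> is. Eliminating with this
  block is again a translation of the rest, by a matrix determined by \<open>v\<close> and
  \<open>w\<close>.\<close>

lemma card_singular_double_pivot:
  assumes p: "prime p" and L: "\<mu> \<le> L" "L > 0"
    and I: "finite I" "i \<in> I" "j \<in> I" "i \<noteq> j"
    and v: "v \<in> res_rows p L S I" "int p dvd v i" "\<not> int p dvd v j"
    and w: "w \<in> res_rows p L S (I - {i})"
  shows "card {B \<in> res_mats p L S (I - {i} - {j}). int p ^ \<mu> dvd det_on I (border i v (border j w B))}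
    = card (singular_mats p L \<mu> S (I - {i} - {j}))"
proof -
  let ?I = "I - {i} - {j}"
  obtain d where d: "[v j * d = 1] (mod int p ^ L)" using prime_power_inverse p v(3) by blast
  define x where "x = v j - d * v i * w j"
  have x: "\<not> int p dvd x"
  proof
    assume "int p dvd x"
    moreover have "int p dvd d * v i * w j" using v(2) by simp
    ultimately have "int p dvd x + d * v i * w j" by (rule dvd_add)
    with v(3) show False by (simp add: x_def)
  qed
  then obtain e where e: "[x * e = 1] (mod int p ^ L)" using prime_power_inverse p by blast
  have unit: "\<not> int p dvd - (v j * x)" using x v(3) p by (simp add: prime_dvd_mult_iff)
  define C where "C = (\<lambda>k l. e * d * (v i * w k * w l + w j * v k * v l) - e * (w k * v l + v k * w l))"
  have det: "int p ^ \<mu> dvd det_on I (border i v (border j w B)) \<longleftrightarrow>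
      int p ^ \<mu> dvd det_on ?I (\<lambda>k l. B k l + C k l)"
    if B: "B \<in> res_mats p L S ?I" for B
  proof -
    define A where "A = border i v (border j w B)"
    have sym: "A k l = A l k" for k l using B by (auto simp: A_def border_def res_mats_def)
    have at: "A i i = v i" "A i j = v j" "A j j = w j" using I(4) by (simp_all add: A_def border_def)
    have "[det_on I A = - (A i j * (A i j - d * A i i * A j j)) * det_on ?I
      (\<lambda>k l. A k l - e * (A k j * A i l + A k i * A j l)
         + e * d * (A i i * A k j * A j l + A j j * A k i * A i l))] (mod int p ^ L)"
      using d e unfolding x_def at[symmetric] by (rule det_on_double_pivot[OF I sym])
    moreover have "det_on ?I (\<lambda>k l. A k l - e * (A k j * A i l + A k i * A j l)
         + e * d * (A i i * A k j * A j l + A j j * A k i * A i l))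
      = det_on ?I (\<lambda>k l. B k l + C k l)"
      using I(4) by (intro det_on_cong) (simp add: A_def C_def border_def)
    ultimately have "[det_on I A = - (v j * x) * det_on ?I (\<lambda>k l. B k l + C k l)] (mod int p ^ L)"
      by (simp only: at x_def)
    then show ?thesis unfolding A_def by (rule prime_power_dvd_cong_unit[OF p L(1) _ unit])
  qed
  have C_sym: "C k l = C l k" for k l by (simp add: C_def ac_simps)
  \<comment> \<open>Each term of \<open>C k l\<close> contains one of \<open>v k\<close>,
    \<open>w k\<close> and one of \<open>v l\<close>, \<open>w l\<close>; at an index in
    \<open>S\<close> both choices are multiples of \<open>p\<close>.\<close>
  have C_dvd: "int p dvd C k l" if "k \<in> ?I" "l \<in> ?I" "k \<in> S \<or> l \<in> S" for k l
  proof -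
    have *: "int p dvd v m \<and> int p dvd w m" if "m \<in> S" "m \<in> ?I" for m
      using that v(1) w by (simp add: res_rows_def residue_entries_def)
    show ?thesis
      using that(3)
    proof
      assume "k \<in> S"
      then have "int p dvd v k" "int p dvd w k" using * that(1) by blast+
      then show ?thesis unfolding C_def by (simp add: dvd_diff dvd_add dvd_mult dvd_mult2)
    next
      assume "l \<in> S"
      then have "int p dvd v l" "int p dvd w l" using * that(2) by blast+
      then show ?thesis unfolding C_def by (simp add: dvd_diff dvd_add dvd_mult dvd_mult2)
    qed
  qed
  have "card {B \<in> res_mats p L S ?I. int p ^ \<mu> dvd det_on I (border i v (border j w B))}
      = card {B \<in> res_mats p L S ?I. int p ^ \<mu> dvd det_on ?I (\<lambda>k l. B k l + C k l)}"
    by (intro arg_cong[where f = card] Collect_cong conj_cong refl det)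
  also have "\<dots> = card (singular_mats p L \<mu> S ?I)"
    using prime_gt_0_nat[OF p] L C_sym C_dvd by (rule card_singular_shift)
  finally show ?thesis .
qed


section \<open>Classification of matrices by one row\<close>

text \<open>By symmetry, divisibility of row \<open>i\<close> is also divisibility of column
  \<open>i\<close>, which is what membership of \<open>i\<close> in \<open>S\<close>
  encodes.\<close>

lemma singular_mats_divisible_row:
  assumes "i \<in> I" "i \<notin> S"
  shows "{A \<in> singular_mats p L \<mu> S I. \<forall>k\<in>I. int p dvd A i k} = singular_mats p L \<mu> (insert i S) I"
proof -
  have "A \<in> res_mats p L (insert i S) I \<longleftrightarrow> A \<in> res_mats p L S I \<and> (\<forall>k\<in>I. int p dvd A i k)" for A
  proof
    assume "A \<in> res_mats p L (insert i S) I"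
    with assms show "A \<in> res_mats p L S I \<and> (\<forall>k\<in>I. int p dvd A i k)"
      by (simp add: res_mats_def residue_entries_def)
  next
    assume A: "A \<in> res_mats p L S I \<and> (\<forall>k\<in>I. int p dvd A i k)"
    then have sym: "A j k = A k j" for j k by (simp add: res_mats_def)
    have "int p dvd A j k" if "j \<in> I" "k \<in> I" "j = i \<or> k = i" for j k
      using A that sym[of j i] by auto
    with A show "A \<in> res_mats p L (insert i S) I"
      by (simp add: res_mats_def residue_entries_def) blast
  qed
  then show ?thesis by (auto simp: singular_mats_def)
qed

text \<open>The rest of the matrix keeps its old constraints when \<open>i\<close> joins
  \<open>S\<close>; only row \<open>i\<close> is restricted, to multiples of \<open>p\<close>. This
  gives the weight of the third case in \<open>card_singular_mats_rec\<close>.\<close>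

lemma card_res_mats_insert:
  assumes "p > 0" "L > 0" "finite I" "S \<subseteq> I" "i \<in> I" "i \<notin> S"
  shows "card (res_mats p L (insert i S) I) = card (res_rows p L I I) * card (res_mats p L S (I - {i}))"
proof -
  \<comment> \<open>With exponent 0 the determinant condition is void, so the statement on singular
    matrices covers all matrices.\<close>
  have "{A \<in> res_mats p L S I. \<forall>k\<in>I. int p dvd A i k} = res_mats p L (insert i S) I"
    using singular_mats_divisible_row[of i I S p L 0] assms by (simp add: singular_mats_def)
  then have "card (res_mats p L (insert i S) I)
    = (\<Sum>v\<in>res_rows p L S I. card {B \<in> res_mats p L S (I - {i}). \<forall>k\<in>I. int p dvd border i v B i k})"
    using card_res_mats_fibres[of I i S p L "\<lambda>A. \<forall>k\<in>I. int p dvd A i k"] assms by simp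
  also have "\<dots> = (\<Sum>v\<in>res_rows p L S I. if v \<in> res_rows p L I I then card (res_mats p L S (I - {i})) else 0)"
  proof (rule sum.cong)
    fix v assume "v \<in> res_rows p L S I"
    then have "v \<in> res_rows p L I I \<longleftrightarrow> (\<forall>k\<in>I. int p dvd v k)"
      by (auto simp: res_rows_def residue_entries_def)
    then have "(\<forall>k\<in>I. int p dvd border i v B i k) \<longleftrightarrow> v \<in> res_rows p L I I" for B
      by (simp add: border_def)
    then show "card {B \<in> res_mats p L S (I - {i}). \<forall>k\<in>I. int p dvd border i v B i k}
        = (if v \<in> res_rows p L I I then card (res_mats p L S (I - {i})) else 0)" by simp
  qed simp
  also have "\<dots> = card (res_rows p L I I) * card (res_mats p L S (I - {i}))"
    using assms res_rows_mono[of S I p L I]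
    by (simp add: sum.If_cases Int_absorb1)
  finally show ?thesis .
qed

text \<open>The rows form a chain of three nested sets: all rows, those with diagonal entry
  divisible by \<open>p\<close>, and those divisible throughout. The two differences collect the
  rows for the scalar pivot and for the double pivot.\<close>

lemma card_singular_mats_row_cases:
  assumes "finite I" "i \<in> I" "i \<notin> S" "S \<subseteq> I" "p > 0" "L > 0"
    and c1: "\<And>v. v \<in> res_rows p L S I \<Longrightarrow> \<not> int p dvd v i \<Longrightarrow>
      card {B \<in> res_mats p L S (I - {i}). int p ^ \<mu> dvd det_on I (border i v B)} = c1"
    and c2: "\<And>v j. v \<in> res_rows p L S I \<Longrightarrow> int p dvd v i \<Longrightarrow> j \<in> I \<Longrightarrow> \<not> int p dvd v j \<Longrightarrow>
      card {B \<in> res_mats p L S (I - {i}). int p ^ \<mu> dvd det_on I (border i v B)} = c2"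
  shows "card (singular_mats p L \<mu> S I)
    = (card (res_rows p L S I) - card (res_rows p L (insert i S) I)) * c1
      + (card (res_rows p L (insert i S) I) - card (res_rows p L I I)) * c2
      + card (singular_mats p L \<mu> (insert i S) I)"
proof -
  let ?R = "res_rows p L S I" and ?R1 = "res_rows p L (insert i S) I" and ?R2 = "res_rows p L I I"
  define f where "f = (\<lambda>v. card {B \<in> res_mats p L S (I - {i}). int p ^ \<mu> dvd det_on I (border i v B)})"
  have R: "?R2 \<subseteq> ?R1" "?R1 \<subseteq> ?R" using assms by (auto intro!: res_rows_mono)
  have fin: "finite ?R" "finite ?R1" "finite ?R2" using assms by auto
  have in_R1: "v \<in> ?R1 \<longleftrightarrow> v \<in> ?R \<and> int p dvd v i" for v
    using assms(2) by (auto simp: res_rows_def residue_entries_def)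
  have in_R2: "v \<in> ?R2 \<longleftrightarrow> v \<in> ?R \<and> (\<forall>k\<in>I. int p dvd v k)" for v
    using assms(4) by (auto simp: res_rows_def residue_entries_def)
  have "card (singular_mats p L \<mu> S I) = sum f ?R"
    unfolding singular_mats_def f_def by (rule card_res_mats_fibres) (use assms in auto)
  also have "sum f ?R = sum f (?R - ?R1) + (sum f (?R1 - ?R2) + sum f ?R2)"
    using fin R by (simp add: sum.subset_diff)
  also have "sum f (?R - ?R1) = (card ?R - card ?R1) * c1"
    using fin R c1 by (simp add: in_R1 f_def card_Diff_subset)
  also have "sum f (?R1 - ?R2) = sum (\<lambda>_. c2) (?R1 - ?R2)"
    by (intro sum.cong refl) (use c2 in \<open>auto simp: in_R1 in_R2 f_def\<close>)
  also have "\<dots> = (card ?R1 - card ?R2) * c2"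
    using fin R by (simp add: card_Diff_subset)
  also have "sum f ?R2 = card (singular_mats p L \<mu> (insert i S) I)"
  proof -
    have "singular_mats p L \<mu> (insert i S) I
        = {A \<in> res_mats p L S I. int p ^ \<mu> dvd det_on I A \<and> (\<forall>k\<in>I. int p dvd A i k)}"
      using singular_mats_divisible_row[of i I S p L \<mu>] assms by (auto simp: singular_mats_def)
    then have "card (singular_mats p L \<mu> (insert i S) I)
      = (\<Sum>v\<in>?R. card {B \<in> res_mats p L S (I - {i}). int p ^ \<mu> dvd det_on I (border i v B)
            \<and> (\<forall>k\<in>I. int p dvd border i v B i k)})"
      using assms by (simp add: card_res_mats_fibres[of I i S p L
         "\<lambda>A. int p ^ \<mu> dvd det_on I A \<and> (\<forall>k\<in>I. int p dvd A i k)"])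
    also have "\<dots> = (\<Sum>v\<in>?R. if v \<in> ?R2 then f v else 0)"
    proof (rule sum.cong)
      fix v assume v: "v \<in> ?R"
      then have "(\<forall>k\<in>I. int p dvd border i v B i k) \<longleftrightarrow> v \<in> ?R2" for B
        by (simp add: border_def in_R2)
      then show "card {B \<in> res_mats p L S (I - {i}). int p ^ \<mu> dvd det_on I (border i v B)
            \<and> (\<forall>k\<in>I. int p dvd border i v B i k)} = (if v \<in> ?R2 then f v else 0)"
        by (simp add: f_def)
    qed simp
    also have "\<dots> = sum f (?R \<inter> ?R2)"
      by (rule sum.inter_restrict[symmetric]) (rule fin)
    also have "?R \<inter> ?R2 = ?R2" using R by blast
    finally show ?thesis by simp
  qed
  finally show ?thesis by simp
qed

text \<open>Dividing all entries by \<open>p\<close> takes \<open>p ^ card I\<close> out of the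
  determinant. The truncated subtraction is the right exponent: for
  \<open>\<mu> \<le> card I\<close> every matrix counts.\<close>

lemma card_mats_scaled:
  assumes "p > 0" "L > 0" "finite I"
  shows "card (singular_mats p L \<mu> I I) = card (singular_mats p (L - 1) (\<mu> - card I) {} I)"
    and "card (res_mats p L I I) = card (res_mats p (L - 1) {} I)"
proof -
  have E: "residue_entries p L True = (\<lambda>x. int p * x) ` {0..<int p ^ (L - 1)}"
    by (rule residue_entries_multiples[OF assms(1,2)])
  have E': "residue_entries p (L - 1) False = {0..<int p ^ (L - 1)}"
    by (auto simp: residue_entries_def)
  have inj: "inj (\<lambda>B j k. int p * B j k)"
    using assms(1) by (auto simp: inj_on_def fun_eq_iff)
  have res: "res_mats p L I I = (\<lambda>B j k. int p * B j k) ` res_mats p (L - 1) {} I"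
  proof (intro equalityI subsetI)
    fix A assume A: "A \<in> res_mats p L I I"
    define B where "B = (\<lambda>j k. A j k div int p)"
    have AB: "\<exists>x\<in>{0..<int p ^ (L - 1)}. A j k = int p * x" if "j \<in> I" "k \<in> I" for j k
      using A that unfolding res_mats_def by (simp add: E image_iff)
    have "B j k \<in> {0..<int p ^ (L - 1)} \<and> A j k = int p * B j k" if "j \<in> I" "k \<in> I" for j k
      using AB[OF that] assms(1) by (auto simp: B_def)
    moreover have "B j k = B k j" for j k
      using A by (simp add: B_def res_mats_def)
    moreover have "A j k = 0 \<and> B j k = 0" if "\<not> (j \<in> I \<and> k \<in> I)" for j k
      using A that by (simp add: B_def res_mats_def)
    ultimately have "B \<in> res_mats p (L - 1) {} I" and "A j k = int p * B j k" for j k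
      unfolding res_mats_def
      by (simp_all add: residue_entries_def del: de_Morgan_conj) (metis mult_zero_right)
    then have "B \<in> res_mats p (L - 1) {} I" "A = (\<lambda>j k. int p * B j k)" by blast+
    then show "A \<in> (\<lambda>B j k. int p * B j k) ` res_mats p (L - 1) {} I" by blast
  next
    fix A assume "A \<in> (\<lambda>B j k. int p * B j k) ` res_mats p (L - 1) {} I"
    then show "A \<in> res_mats p L I I" by (auto simp: res_mats_def E E'[unfolded One_nat_def])
  qed
  show "card (res_mats p L I I) = card (res_mats p (L - 1) {} I)"
    unfolding res by (rule card_image) (rule inj_on_subset[OF inj subset_UNIV])
  have dvd: "int p ^ \<mu> dvd int p ^ card I * D \<longleftrightarrow> int p ^ (\<mu> - card I) dvd D" for D
  proof (cases "\<mu> \<le> card I")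
    case True
    then show ?thesis by (simp add: le_imp_power_dvd dvd_mult2)
  next
    case False
    then have "int p ^ \<mu> = int p ^ card I * int p ^ (\<mu> - card I)"
      by (simp flip: power_add)
    then show ?thesis using assms(1) by simp
  qed
  have sing: "singular_mats p L \<mu> I I = (\<lambda>B j k. int p * B j k) ` singular_mats p (L - 1) (\<mu> - card I) {} I"
    unfolding singular_mats_def res by (auto simp: det_on_scale dvd)
  show "card (singular_mats p L \<mu> I I) = card (singular_mats p (L - 1) (\<mu> - card I) {} I)"
    unfolding sing by (rule card_image) (rule inj_on_subset[OF inj subset_UNIV])
qed

text \<open>Row \<open>i\<close> falls into one of three cases: its diagonal entry is a unit (scalar pivot), the diagonal
  entry is divisible by \<open>p\<close> but some other entry is a unit (pivot block of size 2), or the whole row is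
  divisible by \<open>p\<close>, in which case \<open>i\<close> joins \<open>S\<close>. The three terms of the sum are in this order.\<close>
lemma card_singular_mats_rec:
  fixes g1 g2 g3 :: real
  assumes p: "prime p" and L: "\<mu> \<le> L" "L > 0"
    and I: "finite I" "S \<subseteq> I" "i \<in> I" "i \<notin> S"
  defines "q \<equiv> 1 / real p"
  assumes g1: "real (card (singular_mats p L \<mu> S (I - {i}))) = g1 * card (res_mats p L S (I - {i}))"
    and g2: "\<And>j. j \<in> I - S - {i} \<Longrightarrow>
      real (card (singular_mats p L \<mu> S (I - {i} - {j}))) = g2 * card (res_mats p L S (I - {i} - {j}))"
    and g3: "real (card (singular_mats p L \<mu> (insert i S) I)) = g3 * card (res_mats p L (insert i S) I)"
  shows "real (card (singular_mats p L \<mu> S I))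
    = ((1 - q) * g1 + q * (1 - q ^ (card (I - S) - 1)) * g2 + q ^ card (I - S) * g3)
        * card (res_mats p L S I)"
proof -
  have p0: "p > 0" using p prime_gt_0_nat by blast
  define X where "X = real p ^ (L * card I)"
  define M where "M = real (card (res_mats p L S (I - {i})))"
  define s where "s = card S"
  define m where "m = card (I - S)"
  have finS: "finite S" using I finite_subset by blast
  have m: "card I = s + m" "m > 0"
  proof -
    show "card I = s + m"
      using I finS by (simp add: s_def m_def card_Diff_subset card_mono)
    have "I - S \<noteq> {}" using I by blast
    then show "m > 0" using I(1) by (simp add: m_def card_gt_0_iff)
  qed
  have R0: "real (card (res_rows p L S I)) = q ^ s * X"
    using card_res_rows[OF p0 L(2) I(1,2)] by (simp add: q_def X_def s_def)
  have R1: "real (card (res_rows p L (insert i S) I)) = q * q ^ s * X"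
    using card_res_rows[OF p0 L(2) I(1), of "insert i S"] I finS by (simp add: q_def X_def s_def)
  have R2: "real (card (res_rows p L I I)) = q ^ m * q ^ s * X"
    using card_res_rows[OF p0 L(2) I(1), of I] m by (simp add: q_def X_def power_add)
  have le1: "card (res_rows p L (insert i S) I) \<le> card (res_rows p L S I)"
    using I by (intro card_mono res_rows_mono) auto
  have le2: "card (res_rows p L I I) \<le> card (res_rows p L (insert i S) I)"
    using I by (intro card_mono res_rows_mono) auto
  define c1 where "c1 = card (singular_mats p L \<mu> S (I - {i}))"
  have c1: "card {B \<in> res_mats p L S (I - {i}). int p ^ \<mu> dvd det_on I (border i v B)} = c1"
    if "v \<in> res_rows p L S I" "\<not> int p dvd v i" for v
    unfolding c1_def using that by (intro card_singular_unit_pivot p L I)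
  have c2: "real (card {B \<in> res_mats p L S (I - {i}). int p ^ \<mu> dvd det_on I (border i v B)}) = g2 * M"
    if v: "v \<in> res_rows p L S I" "int p dvd v i" and j: "j \<in> I" "\<not> int p dvd v j" for v j
  proof -
    have j': "j \<noteq> i" "j \<notin> S" "j \<in> I - {i}"
      using v j by (auto simp: res_rows_def residue_entries_def)
    have "card {B \<in> res_mats p L S (I - {i}). int p ^ \<mu> dvd det_on I (border i v B)}
      = (\<Sum>w\<in>res_rows p L S (I - {i}). card {B \<in> res_mats p L S (I - {i} - {j}).
            int p ^ \<mu> dvd det_on I (border i v (border j w B))})"
      by (rule card_res_mats_fibres) (use I j' in auto)
    also have "\<dots> = (\<Sum>w\<in>res_rows p L S (I - {i}). card (singular_mats p L \<mu> S (I - {i} - {j})))"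
      by (intro sum.cong refl card_singular_double_pivot p L I j v j'(1)[symmetric])
    finally have "real (card {B \<in> res_mats p L S (I - {i}). int p ^ \<mu> dvd det_on I (border i v B)})
        = real (card (res_rows p L S (I - {i}))) * (g2 * card (res_mats p L S (I - {i} - {j})))"
      using g2[of j] j j' by simp
    also have "M = real (card (res_rows p L S (I - {i}))) * card (res_mats p L S (I - {i} - {j}))"
      unfolding M_def using card_res_mats_remove[of "I - {i}" j S p L] I j' by simp
    then have "real (card (res_rows p L S (I - {i}))) * (g2 * card (res_mats p L S (I - {i} - {j}))) = g2 * M"
      by simp
    finally show ?thesis .
  qed
  \<comment> \<open>A natural number is wanted here, while the common count is known only as the
    real \<open>g2 * M\<close>. If \<open>m = 1\<close>, no row falls into this case and the weight
    \<open>q - q ^ m\<close> vanishes, so 0 serves. Otherwise some \<open>j\<close> exists, and it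
    exhibits \<open>g2 * M\<close> as a natural number.\<close>
  obtain c2 where c2': "\<And>v j. v \<in> res_rows p L S I \<Longrightarrow> int p dvd v i \<Longrightarrow> j \<in> I \<Longrightarrow> \<not> int p dvd v j \<Longrightarrow>
      card {B \<in> res_mats p L S (I - {i}). int p ^ \<mu> dvd det_on I (border i v B)} = c2"
    and c2M: "(q - q ^ m) * real c2 = (q - q ^ m) * (g2 * M)"
  proof (cases "m = 1")
    case True
    have "False" if "v \<in> res_rows p L S I" "int p dvd v i" "j \<in> I" "\<not> int p dvd v j" for v j
    proof -
      have "j \<in> I - S" "j \<noteq> i" using that by (auto simp: res_rows_def residue_entries_def)
      moreover obtain x where "I - S = {x}" using True m_def card_1_singletonE by metis
      ultimately show False using I by auto
    qed
    then show ?thesis using that[of 0] True by auto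
  next
    case False
    show ?thesis
    proof (cases "\<exists>c. real c = g2 * M")
      case True
      then obtain c where "real c = g2 * M" by blast
      with c2 show ?thesis by (intro that[of c]) (force simp flip: of_nat_eq_iff[where ?'a = real])+
    next
      case False
      obtain j where j: "j \<in> I - S - {i}"
      proof -
        have "card (I - S - {i}) > 0" using \<open>m \<noteq> 1\<close> m(2) I unfolding m_def
          by (subst card_Diff_singleton) auto
        then show ?thesis using that by (auto simp: card_gt_0_iff)
      qed
      have "M = real (card (res_rows p L S (I - {i}))) * card (res_mats p L S (I - {i} - {j}))"
        unfolding M_def using card_res_mats_remove[of "I - {i}" j S p L] I j by simp
      then have "g2 * M = real (card (res_rows p L S (I - {i})) * card (singular_mats p L \<mu> S (I - {i} - {j})))"
        using g2[OF j] by simp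
      with False have False by metis
      then show ?thesis ..
    qed
  qed
  have "card (singular_mats p L \<mu> S I)
    = (card (res_rows p L S I) - card (res_rows p L (insert i S) I)) * c1
      + (card (res_rows p L (insert i S) I) - card (res_rows p L I I)) * c2
      + card (singular_mats p L \<mu> (insert i S) I)"
    by (rule card_singular_mats_row_cases) (use I p0 L c1 c2' in auto)
  then have "real (card (singular_mats p L \<mu> S I))
    = (q ^ s * X - q * q ^ s * X) * real c1 + (q * q ^ s * X - q ^ m * q ^ s * X) * real c2
      + real (card (singular_mats p L \<mu> (insert i S) I))"
    by (simp add: of_nat_diff le1 le2 R0 R1 R2)
  also have "real c1 = g1 * M" using g1 by (simp add: c1_def M_def)
  also have "(q * q ^ s * X - q ^ m * q ^ s * X) * real c2 = q ^ s * X * ((q - q ^ m) * real c2)"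
    by (simp add: algebra_simps)
  also have "\<dots> = q ^ s * X * ((q - q ^ m) * (g2 * M))" by (simp only: c2M)
  also have "real (card (singular_mats p L \<mu> (insert i S) I)) = g3 * (q ^ m * q ^ s * X * M)"
    unfolding g3 using card_res_mats_insert[OF p0 L(2) I] R2 by (simp add: M_def)
  also have "q ^ m = q * q ^ (m - 1)" using m(2) by (cases m) auto
  finally have "real (card (singular_mats p L \<mu> S I))
    = ((1 - q) * g1 + q * (1 - q ^ (m - 1)) * g2 + q * q ^ (m - 1) * g3) * (q ^ s * X * M)"
    by (simp add: algebra_simps)
  also have "q * q ^ (m - 1) = q ^ m" using m(2) by (cases m) auto
  also have "q ^ s * X * M = real (card (res_mats p L S I))"
    using card_res_mats_remove[OF I(1,3,4), of p L] R0 by (simp add: M_def)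
  finally show ?thesis by (simp add: m_def)
qed


section \<open>From the recurrence to the probability\<close>

text \<open>The step and scaling rules with their initial values determine the probability, so any
  \<open>G\<close> that obeys them is this probability. The outer induction on \<open>\<mu>\<close>
  serves the division by \<open>p\<close>, the inner one on \<open>card (I - S)\<close> the
  elimination; \<open>L\<close> varies because the division lowers the precision.\<close>

lemma singular_mats_probability:
  fixes G :: "nat \<Rightarrow> nat \<Rightarrow> nat \<Rightarrow> real"
  assumes p: "prime p"
  defines "q \<equiv> 1 / real p"
  assumes G_0: "\<And>r m. G r m 0 = 1"
    and G_empty: "\<And>\<mu>. \<mu> > 0 \<Longrightarrow> G 0 0 \<mu> = 0"
    and G_scale: "\<And>r \<mu>. G r 0 \<mu> = G 0 r (\<mu> - r)"
    and G_step: "\<And>r m \<mu>. m > 0 \<Longrightarrow> G r m \<mu>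
      = (1 - q) * G r (m - 1) \<mu> + q * (1 - q ^ (m - 1)) * G r (m - 2) \<mu> + q ^ m * G (Suc r) (m - 1) \<mu>"
    and "finite I" "S \<subseteq> I" "\<mu> \<le> L"
  shows "real (card (singular_mats p L \<mu> S I)) = G (card S) (card (I - S)) \<mu> * card (res_mats p L S I)"
  using assms(7-)
proof (induction \<mu> arbitrary: I S L rule: less_induct)
  case outer: (less \<mu>)
  show ?case
  proof (cases "\<mu> = 0")
    case True
    then show ?thesis by (simp add: G_0 singular_mats_def)
  next
    case \<mu>: False
    from outer.prems show ?thesis
    proof (induction "card (I - S)" arbitrary: I S L rule: less_induct)
      case (less I S)
      have L: "L > 0" using \<mu> less.prems by simp
      have p0: "p > 0" using p prime_gt_0_nat by blast
      consider "I = {}" | "S = I" "I \<noteq> {}" | i where "i \<in> I" "i \<notin> S"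
        using less.prems(2) by blast
      then show ?case
      proof cases
        case 1
        then have "singular_mats p L \<mu> S I = {}"
          using \<mu> p prime_gt_1_nat[OF p] by (auto simp: singular_mats_def)
        then show ?thesis using 1 less.prems \<mu> by (simp add: G_empty)
      next
        case 2
        \<comment> \<open>A nonempty index set makes the exponent drop strictly, as the outer
          induction requires.\<close>
        then have r: "card I > 0" using less.prems by (simp add: card_gt_0_iff)
        then have "real (card (singular_mats p (L - 1) (\<mu> - card I) {} I))
            = G (card ({} :: 'a set)) (card (I - {})) (\<mu> - card I) * card (res_mats p (L - 1) {} I)"
          using less.prems \<mu> by (intro outer.IH) auto
        then show ?thesis
          using 2 G_scale[of "card I" \<mu>] card_mats_scaled(1)[OF p0 L less.prems(1), of \<mu>]
            card_mats_scaled(2)[OF p0 L less.prems(1)] by simp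
      next
        case 3
        have finS: "finite S" using less.prems finite_subset by blast
        define m where "m = card (I - S)"
        have m: "m > 0" using 3 less.prems by (auto simp: m_def card_gt_0_iff)
        have m1: "card (I - {i} - S) = m - 1"
        proof -
          have "I - {i} - S = (I - S) - {i}" by blast
          then show ?thesis using 3 less.prems by (simp add: m_def)
        qed
        have m2: "card (I - {i} - {j} - S) = m - 2" if "j \<in> I - S - {i}" for j
        proof -
          have "I - {i} - {j} - S = (I - {i} - S) - {j}" by blast
          then show ?thesis using that m1 by simp
        qed
        have m3: "card (I - insert i S) = m - 1"
        proof -
          have "I - insert i S = I - {i} - S" by blast
          then show ?thesis using m1 by simp
        qed
        have g1: "real (card (singular_mats p L \<mu> S (I - {i})))
            = G (card S) (m - 1) \<mu> * card (res_mats p L S (I - {i}))"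
          unfolding m1[symmetric] using less.prems 3 m m1
          by (intro less.hyps) (auto simp flip: m_def)
        have g2: "real (card (singular_mats p L \<mu> S (I - {i} - {j})))
            = G (card S) (m - 2) \<mu> * card (res_mats p L S (I - {i} - {j}))"
          if "j \<in> I - S - {i}" for j
          unfolding m2[OF that, symmetric] using less.prems 3 m m2[OF that] that
          by (intro less.hyps) (auto simp flip: m_def)
        have "real (card (singular_mats p L \<mu> (insert i S) I))
            = G (card (insert i S)) (card (I - insert i S)) \<mu> * card (res_mats p L (insert i S) I)"
          using less.prems 3 m m3 by (intro less.hyps) (auto simp flip: m_def)
        then have g3: "real (card (singular_mats p L \<mu> (insert i S) I))
            = G (Suc (card S)) (m - 1) \<mu> * card (res_mats p L (insert i S) I)"
          using 3 finS by (simp add: m3)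
        have "real (card (singular_mats p L \<mu> S I))
          = ((1 - q) * G (card S) (m - 1) \<mu> + q * (1 - q ^ (card (I - S) - 1)) * G (card S) (m - 2) \<mu>
              + q ^ card (I - S) * G (Suc (card S)) (m - 1) \<mu>) * card (res_mats p L S I)"
          unfolding q_def
          using p less.prems(3) L less.prems(1,2) 3 g1 g2 g3
          by (rule card_singular_mats_rec)
        then show ?thesis using G_step[OF m, of "card S" \<mu>] by (simp add: m_def)
      qed
    qed
  qed
qed

section \<open>Products and binomials in \<open>q\<close>\<close>

lemma Pi_q_0 [simp]: "Pi_q 0 q = 1"
  by (simp add: Pi_q_def)

lemma Pi_q_Suc: "Pi_q (Suc n) q = (1 - q ^ Suc n) * Pi_q n q"
  by (simp add: Pi_q_def)

lemma Pi_q_pos: "0 < q \<Longrightarrow> q < 1 \<Longrightarrow> 0 < Pi_q n q"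
  by (induction n) (simp_all add: Pi_q_Suc power_Suc_less_one del: power_Suc)

text \<open>The \<open>q\<close>-Pochhammer symbol \<open>(q; q^2)_n\<close>, over a general ring
  because it is used both for reals and for power series.\<close>

definition odd_Pi :: "nat \<Rightarrow> 'a :: comm_ring_1 \<Rightarrow> 'a" where
  "odd_Pi n q = (\<Prod>i<n. 1 - q ^ (2 * i + 1))"

lemma odd_Pi_0 [simp]: "odd_Pi 0 q = 1"
  by (simp add: odd_Pi_def)

lemma odd_Pi_Suc: "odd_Pi (Suc n) q = (1 - q ^ (2 * n + 1)) * odd_Pi n q"
  by (simp add: odd_Pi_def mult.commute)

lemma Pi_q_double:
  "Pi_q (2 * k) q = odd_Pi k q * Pi_q k (q ^ 2)"
proof (induction k)
  case (Suc k)
  have "Pi_q (2 * Suc k) q = (1 - q ^ (2 * k + 2)) * ((1 - q ^ (2 * k + 1)) * Pi_q (2 * k) q)"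
    by (simp add: Pi_q_Suc)
  also have "q ^ (2 * k + 2) = (q ^ 2) ^ Suc k" unfolding power_mult[symmetric] by simp
  finally show ?case by (simp add: Suc Pi_q_Suc odd_Pi_Suc del: power_Suc)
qed simp

lemma Pi_q_double_Suc:
  "Pi_q (2 * k + 1) q = odd_Pi (Suc k) q * Pi_q k (q ^ 2)"
  using Pi_q_Suc[of "2 * k" q] by (simp add: Pi_q_double odd_Pi_Suc)

text \<open>Gaussian binomial coefficients through a Pascal rule, which avoids division and so makes
  sense in any commutative ring.\<close>

fun qbinom :: "'a :: comm_ring_1 \<Rightarrow> nat \<Rightarrow> nat \<Rightarrow> 'a" where
  "qbinom Q n 0 = 1"
| "qbinom Q 0 (Suc k) = 0"
| "qbinom Q (Suc n) (Suc k) = Q ^ Suc k * qbinom Q n (Suc k) + qbinom Q n k"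

lemma qbinom_eq_0: "n < k \<Longrightarrow> qbinom Q n k = 0"
  by (induction Q n k rule: qbinom.induct) auto

lemma qbinom_fps_const: "qbinom (fps_const Q) n k = fps_const (qbinom Q n k)"
  by (induction Q n k rule: qbinom.induct) (simp_all del: power_Suc)

text \<open>With \<open>n = k + l + 1\<close>, the Pascal rule becomes
  \<open>Q^(k+1) (1 - Q^(l+1)) + (1 - Q^(k+1)) = 1 - Q^(k+l+2)\<close>.\<close>

lemma qbinom_Pi_q:
  "k \<le> n \<Longrightarrow> qbinom Q n k * (Pi_q k Q * Pi_q (n - k) Q) = Pi_q n Q"
proof (induction Q n k rule: qbinom.induct)
  case (3 Q n k)
  show ?case
  proof (cases "k = n")
    case True
    then have "qbinom Q n k * Pi_q k Q = Pi_q n Q" using 3(2) by simp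
    moreover have "qbinom Q n (Suc k) = 0" using True by (simp add: qbinom_eq_0)
    ultimately show ?thesis using True by (simp add: Pi_q_Suc del: power_Suc)
  next
    case False
    define l where "l = n - Suc k"
    from False 3(3) have n: "n = Suc (k + l)" by (simp add: l_def)
    have IH: "qbinom Q n (Suc k) * (Pi_q (Suc k) Q * Pi_q l Q) = Pi_q n Q"
      "qbinom Q n k * (Pi_q k Q * Pi_q (Suc l) Q) = Pi_q n Q"
      using 3(1,2) by (simp_all add: n)
    have "qbinom Q (Suc n) (Suc k) * (Pi_q (Suc k) Q * Pi_q (Suc n - Suc k) Q)
      = Q ^ Suc k * (1 - Q ^ Suc l) * (qbinom Q n (Suc k) * (Pi_q (Suc k) Q * Pi_q l Q))
        + (1 - Q ^ Suc k) * (qbinom Q n k * (Pi_q k Q * Pi_q (Suc l) Q))"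
      by (simp add: n Pi_q_Suc algebra_simps del: power_Suc)
    also have "\<dots> = (1 - Q ^ (Suc k + Suc l)) * Pi_q n Q"
      unfolding IH power_add by (simp add: algebra_simps del: power_Suc)
    finally show ?thesis by (simp add: n Pi_q_Suc)
  qed
qed simp_all

text \<open>The shift \<open>a\<close> makes the induction on \<open>N\<close> go through: under the Pascal rule the term with
  factor \<open>z Q^(a+1)\<close> that arises from \<open>V_step\<close> cancels the second half of the sum.\<close>
lemma q_Vandermonde:
  fixes V :: "nat \<Rightarrow> 'a :: comm_ring_1"
  assumes V_step: "\<And>k. V k = V (Suc k) * (1 - z * Q ^ Suc k)"
  shows "(\<Sum>k\<le>N. qbinom Q N k * Q ^ (k * (k + a)) * z ^ k * V (k + a)) = V (N + a)"
proof (induction N arbitrary: a)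
  case (Suc N)
  define t where "t = (\<lambda>k. qbinom Q N k * Q ^ (k * (k + Suc a)) * z ^ k * V (k + Suc a))"
  have a: "qbinom Q N k * Q ^ (k * (k + Suc a)) * z ^ k * V (k + a)
      = t k - z * Q ^ Suc a * (Q ^ k * t k)" for k
    unfolding t_def V_step[of "k + a"] by (simp add: algebra_simps power_add)
  have b: "qbinom Q N k * Q ^ (Suc k * (Suc k + a)) * z ^ Suc k * V (Suc k + a)
      = z * Q ^ Suc a * (Q ^ k * t k)" for k
    unfolding t_def by (simp add: algebra_simps power_add)
  have "(\<Sum>k\<le>Suc N. qbinom Q (Suc N) k * Q ^ (k * (k + a)) * z ^ k * V (k + a))
    = (\<Sum>k\<le>Suc N. qbinom Q N k * Q ^ (k * (k + Suc a)) * z ^ k * V (k + a))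
      + (\<Sum>k\<le>N. qbinom Q N k * Q ^ (Suc k * (Suc k + a)) * z ^ Suc k * V (Suc k + a))"
    unfolding sum.atMost_Suc_shift
    by (simp add: algebra_simps power_add sum.distrib del: sum.atMost_Suc)
  also have "\<dots> = (\<Sum>k\<le>N. t k)"
    by (simp only: sum.atMost_Suc[of _ N] qbinom_eq_0[OF lessI] mult_zero_left add_0_right)
       (simp only: a b sum_subtractf diff_add_cancel)
  also have "\<dots> = V (Suc N + a)"
    using Suc[of "Suc a"] by (simp add: t_def)
  finally show ?case .
qed simp

section \<open>The corank distribution\<close>

text \<open>The probability that a random symmetric \<open>m \<times> m\<close> matrix over the field with \<open>p = 1/q\<close> elements
  has corank \<open>j\<close>. Only the recurrence below is needed, not this interpretation.\<close>
definition corank_prob :: "real \<Rightarrow> nat \<Rightarrow> nat \<Rightarrow> real" where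
  "corank_prob q m j = (if j \<le> m then q ^ (\<Sum>{..j}) * Pi_q m q
     / (Pi_q j q * Pi_q ((m - j) div 2) (q ^ 2)) else 0)"

text \<open>For \<open>j < m\<close> every term is an explicit multiple of one quantity
  \<open>K\<close>, so only an elementary identity in powers of \<open>q\<close> is left. It has two
  forms, since \<open>(m - 1 - j) div 2\<close> equals \<open>h\<close> or \<open>h - 1\<close>
  according to the parity of \<open>m - j\<close>.\<close>

lemma corank_prob_rec:
  assumes q: "0 < q" "q < 1" and m: "m > 0"
  shows "corank_prob q m j = (1 - q) * corank_prob q (m - 1) j
    + q * (1 - q ^ (m - 1)) * corank_prob q (m - 2) j
    + q ^ m * (if j = 0 then 0 else corank_prob q (m - 1) (j - 1))"
proof (cases "j \<le> m")
  case False
  with m show ?thesis by (cases m; cases j) (simp_all add: corank_prob_def)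
next
  case jm: True
  define h where "h = (m - j) div 2"
  define K where "K = q ^ (\<Sum>{..j}) * Pi_q (m - 1) q / (Pi_q j q * Pi_q h (q ^ 2))"
  have q2: "0 < q ^ 2" "q ^ 2 < 1" using q by (simp_all add: power_less_one_iff)
  have fac: "1 - q ^ Suc i \<noteq> 0" "1 - (q ^ 2) ^ Suc i \<noteq> 0" for i
    using power_Suc_less_one[of q i] power_Suc_less_one[of "q ^ 2" i] q q2 by simp_all
  have cancel: "(1 - (q ^ 2) ^ h) * K
      = q ^ (\<Sum>{..j}) * Pi_q (m - 1) q / (Pi_q j q * Pi_q g (q ^ 2))" if "h = Suc g" for g
  proof -
    have *: "x * (a / (b * (x * c))) = a / (b * c)" if "x \<noteq> 0" for x a b c :: real
      using that by simp
    show ?thesis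
      unfolding K_def that Pi_q_Suc by (rule *) (rule fac)
  qed
  have 0: "corank_prob q m j = (1 - q ^ m) * K"
    using jm m Pi_q_Suc[of "m - 1" q] by (simp add: corank_prob_def K_def h_def)
  have 3: "q ^ m * (if j = 0 then 0 else corank_prob q (m - 1) (j - 1)) = q ^ (m - j) * (1 - q ^ j) * K"
  proof (cases j)
    case (Suc i)
    define T where "T = q ^ (\<Sum>{..i})"
    have "m - 1 - i = m - j" "i \<le> m - 1" using Suc jm by auto
    then have 1: "corank_prob q (m - 1) i = T * Pi_q (m - 1) q / (Pi_q i q * Pi_q h (q ^ 2))"
      by (simp only: corank_prob_def T_def h_def if_True)
    have "q ^ (\<Sum>{..j}) = T * q ^ j" by (simp only: Suc T_def sum.atMost_Suc power_add)
    then have 2: "K = T * q ^ j * Pi_q (m - 1) q / ((1 - q ^ j) * Pi_q i q * Pi_q h (q ^ 2))"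
      by (simp only: K_def Suc Pi_q_Suc)
    have "q ^ m = q ^ (m - j) * q ^ j" using jm by (simp flip: power_add)
    moreover have "(1 - q ^ j) * K = q ^ j * corank_prob q (m - 1) i"
      unfolding 1 2 using fac(1)[of i, folded Suc] by (simp add: mult.assoc)
    ultimately show ?thesis by (simp add: Suc mult.assoc del: power_Suc)
  qed simp
  show ?thesis
  proof (cases "j = m")
    case True
    then have "corank_prob q (m - 1) j = 0" "corank_prob q (m - 2) j = 0"
      using m by (simp_all add: corank_prob_def)
    then show ?thesis using True 0 3 by simp
  next
    case False
    with jm have lt: "j < m" by simp
    have 2: "(1 - q ^ (m - 1)) * corank_prob q (m - 2) j = (1 - (q ^ 2) ^ h) * K"
    proof (cases "j + 2 \<le> m")
      case True
      then obtain g where h: "h = Suc g" "(m - 2 - j) div 2 = g"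
        unfolding h_def by (cases "(m - j) div 2") auto
      from True have "2 \<le> m" by simp
      then obtain i where "m = 2 + i" using le_Suc_ex by blast
      then have i: "m = Suc (Suc i)" by simp
      show ?thesis
        unfolding cancel[OF h(1)] using True h(2) i by (simp add: corank_prob_def Pi_q_Suc)
    next
      case False
      \<comment> \<open>For \<open>m = 1\<close> the index \<open>m - 2\<close> truncates to 0, but
        then the factor \<open>1 - q ^ (m - 1)\<close> is zero.\<close>
      with lt have "m = Suc j" by simp
      then show ?thesis by (cases j) (simp_all add: corank_prob_def h_def)
    qed
    show ?thesis
    proof (cases "even (m - j)")
      case True
      then have d: "m - j = 2 * h" by (simp add: h_def)
      with lt obtain g where h: "h = Suc g" by (cases h) auto
      have "m - 1 - j = 2 * g + 1" using d h by simp
      then have "(m - 1 - j) div 2 = g" by simp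
      then have 1: "corank_prob q (m - 1) j = (1 - (q ^ 2) ^ h) * K"
        unfolding cancel[OF h] using lt by (simp add: corank_prob_def)
      have e: "q ^ (m - j) = (q ^ 2) ^ h" by (simp add: d power_mult)
      have "m = (m - j) + j" using lt by simp
      then have e': "q ^ m = (q ^ 2) ^ h * q ^ j" unfolding e[symmetric] power_add[symmetric] by simp
      have "(1 - Y * Z) * K = (1 - q) * ((1 - Y) * K) + q * ((1 - Y) * K) + Y * (1 - Z) * K" for Y Z
        by (simp add: algebra_simps)
      from this[of "(q ^ 2) ^ h" "q ^ j"] show ?thesis
        unfolding 3 mult.assoc[of q "1 - q ^ (m - 1)"] 2 unfolding 0 1 e e' .
    next
      case False
      then have d: "m - j = 2 * h + 1"
        using odd_two_times_div_two_succ[of "m - j"] by (simp add: h_def)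
      have "m - 1 - j = 2 * h" using d by simp
      then have "(m - 1 - j) div 2 = h" by simp
      then have 1: "corank_prob q (m - 1) j = K"
        using lt by (simp add: corank_prob_def K_def)
      have e: "q ^ (m - j) = q * (q ^ 2) ^ h" by (simp add: d power_mult)
      have "m = (m - j) + j" using lt by simp
      then have e': "q ^ m = q * (q ^ 2) ^ h * q ^ j" unfolding e[symmetric] power_add[symmetric] by simp
      have "(1 - q * Y * Z) * K = (1 - q) * K + q * ((1 - Y) * K) + q * Y * (1 - Z) * K" for Y Z
        by (simp add: algebra_simps)
      from this[of "(q ^ 2) ^ h" "q ^ j"] show ?thesis
        unfolding 3 mult.assoc[of q "1 - q ^ (m - 1)"] 2 unfolding 0 1 e e' .
    qed
  qed
qed

definition corank_mean :: "real \<Rightarrow> nat \<Rightarrow> (nat \<Rightarrow> real) \<Rightarrow> real" where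
  "corank_mean q m f = (\<Sum>j\<le>m. corank_prob q m j * f j)"

lemma corank_mean_0: "corank_mean q 0 f = f 0"
  by (simp add: corank_mean_def corank_prob_def)

text \<open>The index shift in \<open>corank_prob_rec\<close> moves onto \<open>f\<close>. Applied
  to a function of \<open>r + j\<close>, this shift is the passage from \<open>r\<close> to
  \<open>Suc r\<close>.\<close>

lemma corank_mean_rec:
  assumes q: "0 < q" "q < 1" and m: "m > 0"
  shows "corank_mean q m f = (1 - q) * corank_mean q (m - 1) f
    + q * (1 - q ^ (m - 1)) * corank_mean q (m - 2) f
    + q ^ m * corank_mean q (m - 1) (\<lambda>j. f (Suc j))"
proof -
  have ext: "corank_mean q n f = (\<Sum>j\<le>m. corank_prob q n j * f j)" if "n \<le> m" for n
    unfolding corank_mean_def using that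
    by (intro sum.mono_neutral_left) (auto simp: corank_prob_def)
  obtain l where l: "m = Suc l" using m by (cases m) auto
  have shift: "corank_mean q (m - 1) (\<lambda>j. f (Suc j))
      = (\<Sum>j\<le>m. (if j = 0 then 0 else corank_prob q (m - 1) (j - 1)) * f j)"
    unfolding l by (subst sum.atMost_Suc_shift) (simp add: corank_mean_def)
  have "corank_mean q m f = (\<Sum>j\<le>m. (1 - q) * (corank_prob q (m - 1) j * f j)
      + q * (1 - q ^ (m - 1)) * (corank_prob q (m - 2) j * f j)
      + q ^ m * ((if j = 0 then 0 else corank_prob q (m - 1) (j - 1)) * f j))"
    unfolding corank_mean_def
    by (intro sum.cong refl, subst corank_prob_rec[OF q m]) (simp only: algebra_simps)
  then show ?thesis
    by (simp only: sum.distrib sum_distrib_left ext[of "m - 1"] ext[of "m - 2"] diff_le_self shift)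
qed

text \<open>The coefficients \<open>1 - q\<close>, \<open>q (1 - q^(m-1))\<close> and
  \<open>q^m\<close> of the recurrence add up to 1, so the weights have total mass one by
  induction.\<close>

lemma corank_mean_const:
  assumes q: "0 < q" "q < 1"
  shows "corank_mean q m (\<lambda>_. c) = c"
proof (induction m rule: less_induct)
  case (less m)
  show ?case
  proof (cases m)
    case (Suc l)
    then have IH: "corank_mean q (m - 1) (\<lambda>_. c) = c" "corank_mean q (m - 2) (\<lambda>_. c) = c"
      using less[of "m - 1"] less[of "m - 2"] by auto
    have "q ^ m = q * q ^ (m - 1)" using Suc by simp
    then show ?thesis
      using corank_mean_rec[OF q, of m "\<lambda>_. c"] Suc unfolding IH by (simp add: algebra_simps)
  qed (simp add: corank_mean_0)
qed


section \<open>The generating function of the valuation\<close>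

text \<open>With \<open>z = q x\<^sup>2\<close> and \<open>Q = q\<^sup>2\<close> this is \<open>1 / ((1 - z Q) \<dots> (1 - z Q^k))\<close>.\<close>
primrec zeta_denom :: "real \<Rightarrow> nat \<Rightarrow> real fps" where
  "zeta_denom q 0 = 1"
| "zeta_denom q (Suc k) = zeta_denom q k * inverse (1 - fps_const q ^ (2 * k + 3) * fps_X ^ 2)"

lemma zeta_denom_step:
  "zeta_denom q k = zeta_denom q (Suc k) * (1 - fps_const q ^ (2 * k + 3) * fps_X ^ 2)"
proof -
  let ?f = "1 - fps_const q ^ (2 * k + 3) * fps_X ^ 2 :: real fps"
  have "inverse ?f * ?f = 1" by (rule inverse_mult_eq_1) (simp add: fps_mult_nth_0)
  then show ?thesis by (simp add: mult.assoc)
qed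

text \<open>This is \<open>(1 - q x) Z_n\<close>, with the product formulas for
  \<open>Z_(2k)\<close> and \<open>Z_(2k+1)\<close> merged into one expression.\<close>

definition zeta_num :: "real \<Rightarrow> nat \<Rightarrow> real fps" where
  "zeta_num q n = odd_Pi ((n + 1) div 2) (fps_const q)
     * (if even n then 1 - fps_const q ^ (n + 1) * fps_X else 1) * zeta_denom q (n div 2)"

lemma odd_Pi_fps_const: "odd_Pi n (fps_const q) = fps_const (odd_Pi n q)"
  by (induction n) (simp_all add: odd_Pi_Suc del: power_Suc fps_const_sub flip: fps_const_sub fps_const_1_eq_1)

lemma Pi_q_parity:
  "Pi_q n q = odd_Pi ((n + 1) div 2) q * Pi_q (n div 2) (q ^ 2)"
proof (cases "even n")
  case True
  then show ?thesis by (elim evenE) (simp add: Pi_q_double)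
next
  case False
  then show ?thesis by (elim oddE) (use Pi_q_double_Suc in simp)
qed

lemma sum_atMost_double: "(\<Sum>{..2 * k}) = k * (2 * k + 1)" for k :: nat
  by (induction k) (simp_all add: algebra_simps)

text \<open>Splitting \<open>Pi_q n q\<close> and \<open>Pi_q (2 * k) q\<close> into odd and even
  factors leaves a Gaussian binomial in base \<open>q^2\<close>. The multiplier
  \<open>odd_Pi k q\<close> is the one supplied by \<open>zeta_num q (2 * k)\<close>.\<close>

lemma corank_prob_even_index:
  assumes q: "0 < q" "q < 1" and k: "k \<le> n div 2"
  shows "corank_prob q n (2 * k) * odd_Pi k q
    = q ^ (k * (2 * k + 1)) * odd_Pi ((n + 1) div 2) q * qbinom (q ^ 2) (n div 2) k"
proof -
  have q2: "0 < q ^ 2" "q ^ 2 < 1" using q by (simp_all add: power_less_one_iff)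
  have nz: "Pi_q i q \<noteq> 0" "Pi_q i (q ^ 2) \<noteq> 0" for i
    using Pi_q_pos[OF q, of i] Pi_q_pos[OF q2, of i] by simp_all
  have o: "odd_Pi k q \<noteq> 0" using nz(1)[of "2 * k"] by (simp add: Pi_q_double)
  have "(n - 2 * k) div 2 = n div 2 - k" "2 * k \<le> n" using k by auto
  then have "corank_prob q n (2 * k) * odd_Pi k q
    = q ^ (k * (2 * k + 1)) * (odd_Pi ((n + 1) div 2) q * Pi_q (n div 2) (q ^ 2))
       / (Pi_q k (q ^ 2) * Pi_q (n div 2 - k) (q ^ 2))"
    using o unfolding Pi_q_parity[symmetric] corank_prob_def Pi_q_double
    by (simp add: sum_atMost_double)
  also have "\<dots> = q ^ (k * (2 * k + 1)) * odd_Pi ((n + 1) div 2) q * qbinom (q ^ 2) (n div 2) k"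
    using nz by (simp add: qbinom_Pi_q[OF k, symmetric])
  finally show ?thesis .
qed

text \<open>For even \<open>n\<close> the number \<open>(n - (2 * k + 1)) div 2\<close> is one less
  than \<open>n div 2 - k\<close>, whence the extra factor. That factor vanishes at
  \<open>2 * k = n\<close>, where corank \<open>2 * k + 1\<close> is impossible.\<close>

lemma corank_prob_odd_index:
  assumes q: "0 < q" "q < 1" and k: "k \<le> n div 2"
  shows "corank_prob q n (2 * k + 1) * odd_Pi (Suc k) q
    = q ^ (k * (2 * k + 1)) * q ^ (2 * k + 1) * (if even n then 1 - (q ^ 2) ^ (n div 2 - k) else 1)
      * odd_Pi ((n + 1) div 2) q * qbinom (q ^ 2) (n div 2) k"
proof (cases "2 * k + 1 \<le> n")
  case False
  moreover have "2 * k \<le> n" using k by simp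
  ultimately have "n = 2 * k" by linarith
  with False show ?thesis by (simp add: corank_prob_def)
next
  case True
  define N where "N = n div 2"
  have q2: "0 < q ^ 2" "q ^ 2 < 1" using q by (simp_all add: power_less_one_iff)
  have nz: "Pi_q i q \<noteq> 0" "Pi_q i (q ^ 2) \<noteq> 0" for i
    using Pi_q_pos[OF q, of i] Pi_q_pos[OF q2, of i] by simp_all
  have o: "odd_Pi (Suc k) q \<noteq> 0"
    using nz(1)[of "2 * k + 1"] unfolding Pi_q_double_Suc by auto
  have P: "Pi_q (N - k) (q ^ 2) = (if even n then 1 - (q ^ 2) ^ (N - k) else 1) * Pi_q ((n - (2 * k + 1)) div 2) (q ^ 2)"
  proof (cases "even n")
    case even: True
    define h where "h = (n - (2 * k + 1)) div 2"
    have "n = 2 * N" using even by (simp add: N_def)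
    then obtain g where g: "N - k = Suc g" using True by (cases "N - k") auto
    then have "n - (2 * k + 1) = 2 * g + 1" using \<open>n = 2 * N\<close> by linarith
    then have "N - k = Suc h" using g by (simp add: h_def)
    then show ?thesis using even by (simp add: Pi_q_Suc h_def del: power_Suc)
  next
    case False
    then have "n = 2 * N + 1" using odd_two_times_div_two_succ[of n] by (simp add: N_def)
    then have "n - (2 * k + 1) = 2 * (N - k)" by simp
    then have "(n - (2 * k + 1)) div 2 = N - k" by simp
    then show ?thesis using False by simp
  qed
  have e: "(\<Sum>{..2 * k + 1}) = k * (2 * k + 1) + (2 * k + 1)"
    using sum_atMost_double[of k] by simp
  have "corank_prob q n (2 * k + 1) * odd_Pi (Suc k) q
    = q ^ (k * (2 * k + 1)) * q ^ (2 * k + 1) * (odd_Pi ((n + 1) div 2) q * Pi_q N (q ^ 2))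
       / (Pi_q k (q ^ 2) * Pi_q ((n - (2 * k + 1)) div 2) (q ^ 2))"
    using o True unfolding N_def Pi_q_parity[symmetric] corank_prob_def Pi_q_double_Suc
      e power_add[of q "k * (2 * k + 1)" "2 * k + 1"] by simp
  also have "Pi_q N (q ^ 2) = qbinom (q ^ 2) N k * (Pi_q k (q ^ 2) * Pi_q (N - k) (q ^ 2))"
    using qbinom_Pi_q[of k N "q ^ 2"] k by (simp add: N_def)
  finally show ?thesis
    using nz unfolding P by (simp add: N_def)
qed

lemma sum_pairs: "(\<Sum>r\<le>2 * N + 1. f r) = (\<Sum>k\<le>N. f (2 * k) + f (2 * k + 1))"
  for f :: "nat \<Rightarrow> 'a :: comm_monoid_add"
  by (induction N) (simp_all add: add.assoc)

lemma zeta_num_fixed_point: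
  assumes q: "0 < q" "q < 1"
  shows "(\<Sum>r\<le>n. fps_const (corank_prob q n r) * fps_X ^ r * zeta_num q r) = zeta_num q n"
proof -
  define c where "c = (fps_const q :: real fps)"
  define N where "N = n div 2"
  define L where "L = odd_Pi ((n + 1) div 2) c * (if even n then 1 - c ^ (n + 1) * fps_X else 1)"
  define b where "b = (\<lambda>k. qbinom (c ^ 2) N k * (c ^ 2) ^ (k * k) * (c * fps_X ^ 2) ^ k * zeta_denom q k)"
  let ?f = "\<lambda>r. fps_const (corank_prob q n r) * fps_X ^ r * zeta_num q r"
  have pair: "?f (2 * k) + ?f (2 * k + 1) = L * b k" if "k \<le> N" for k
  proof -
    have "fps_const (corank_prob q n (2 * k)) * odd_Pi k c
        = c ^ (k * (2 * k + 1)) * odd_Pi ((n + 1) div 2) c * qbinom (c ^ 2) N k"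
      using corank_prob_even_index[OF q, of k n] that
      by (simp add: c_def odd_Pi_fps_const qbinom_fps_const N_def)
    then have 1: "?f (2 * k) = c ^ (k * (2 * k + 1)) * odd_Pi ((n + 1) div 2) c * qbinom (c ^ 2) N k
        * fps_X ^ (2 * k) * (1 - c ^ (2 * k + 1) * fps_X) * zeta_denom q k"
      by (simp add: zeta_num_def mult_ac flip: c_def)
    define w where "w = (if even n then 1 - (c ^ 2) ^ (N - k) else 1)"
    have w: "w = fps_const (if even n then 1 - (q ^ 2) ^ (N - k) else 1)" by (simp add: w_def c_def)
    have "fps_const (corank_prob q n (2 * k + 1)) * odd_Pi (Suc k) c
        = c ^ (k * (2 * k + 1)) * c ^ (2 * k + 1) * w * odd_Pi ((n + 1) div 2) c * qbinom (c ^ 2) N k"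
      using corank_prob_odd_index[OF q, of k n] that unfolding w
      by (simp add: c_def odd_Pi_fps_const qbinom_fps_const N_def)
    then have 2: "?f (2 * k + 1) = c ^ (k * (2 * k + 1)) * c ^ (2 * k + 1) * w * odd_Pi ((n + 1) div 2) c
        * qbinom (c ^ 2) N k * fps_X ^ (2 * k + 1) * zeta_denom q k"
      by (simp add: zeta_num_def mult_ac flip: c_def)
    \<comment> \<open>For even \<open>n\<close> the powers multiply to \<open>c ^ (n + 1)\<close>,
      so the linear factor of a pair no longer depends on \<open>k\<close> and can leave the
      sum.\<close>
    have w': "1 - c ^ (2 * k + 1) * fps_X + c ^ (2 * k + 1) * w * fps_X
        = (if even n then 1 - c ^ (n + 1) * fps_X else 1)"
    proof (cases "even n")
      case True
      have "n = 2 * N" using True by (simp add: N_def)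
      then have "n + 1 = (2 * k + 1) + 2 * (N - k)" using that by simp
      then have "c ^ (n + 1) = c ^ (2 * k + 1) * (c ^ 2) ^ (N - k)"
        by (simp only: power_add power_mult)
      then show ?thesis using True by (simp add: w_def algebra_simps)
    qed (simp add: w_def)
    have "?f (2 * k) + ?f (2 * k + 1) = c ^ (k * (2 * k + 1)) * odd_Pi ((n + 1) div 2) c
       * qbinom (c ^ 2) N k * fps_X ^ (2 * k) * zeta_denom q k
       * (1 - c ^ (2 * k + 1) * fps_X + c ^ (2 * k + 1) * w * fps_X)"
      unfolding 1 2 by (simp add: algebra_simps)
    moreover have "c ^ (k * (2 * k + 1)) = (c ^ 2) ^ (k * k) * c ^ k"
      by (simp only: power_mult[symmetric] power_add[symmetric]) (simp add: algebra_simps)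
    moreover have "fps_X ^ (2 * k) = (fps_X ^ 2 :: real fps) ^ k" by (rule power_mult)
    ultimately show ?thesis
      unfolding w' L_def b_def by (simp only: power_mult_distrib mult_ac)
  qed
  \<comment> \<open>For even \<open>n\<close> this adds the index \<open>n + 1\<close>, where the
    corank probability is zero, so that all indices pair up.\<close>
  have "(\<Sum>r\<le>n. ?f r) = (\<Sum>r\<le>2 * N + 1. ?f r)"
    by (rule sum.mono_neutral_left) (auto simp: corank_prob_def N_def)
  also have "\<dots> = L * (\<Sum>k\<le>N. b k)"
    unfolding sum_pairs sum_distrib_left by (intro sum.cong refl pair) simp
  also have "(\<Sum>k\<le>N. b k) = zeta_denom q N"
  proof -
    \<comment> \<open>This is the hypothesis of \<open>q_Vandermonde\<close> for
      \<open>z = q x^2\<close> and \<open>Q = q^2\<close>.\<close>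
    have "zeta_denom q k = zeta_denom q (Suc k) * (1 - c * fps_X ^ 2 * (c ^ 2) ^ Suc k)" for k
    proof -
      have "c * fps_X ^ 2 * (c ^ 2) ^ Suc k = c ^ (2 * k + 3) * fps_X ^ 2"
      proof -
        have "2 * k + 3 = Suc (2 * Suc k)" by simp
        then have "c ^ (2 * k + 3) = c * (c ^ 2) ^ Suc k" by (simp only: power_Suc power_mult)
        then show ?thesis by (simp only: mult_ac)
      qed
      then show ?thesis using zeta_denom_step unfolding c_def by metis
    qed
    from q_Vandermonde[of "zeta_denom q", OF this, where N = N and a = 0]
    show ?thesis by (simp add: b_def)
  qed
  finally show ?thesis unfolding zeta_num_def L_def N_def c_def .
qed


section \<open>The claimed values and the generating function of the remainder\<close>

definition R_term :: "real \<Rightarrow> nat \<Rightarrow> nat \<Rightarrow> real" where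
  "R_term q n \<mu> = q ^ ((\<mu> - 1) div 2 + 1) * (\<Sum>j<n div 2.
     (q ^ \<mu> * (1 - q ^ n) - q ^ (2 * ((\<mu> - 1) div 2) + 2) * (1 - q ^ (2 * j + 1))) * q ^ (2 * j)
       * (Pi_q (2 * j) q * Pi_q (j + (\<mu> - 1) div 2) (q ^ 2))
       / ((Pi_q j (q ^ 2))\<^sup>2 * Pi_q ((\<mu> - 1) div 2) (q ^ 2)))"

text \<open>The value 1 at \<open>\<mu> = 0\<close> reflects that \<open>p^0\<close> divides
  everything. With truncated subtraction, \<open>Q_value q r (\<mu> - r)\<close> is then also right
  for \<open>\<mu> \<le> r\<close>.\<close>

definition Q_value :: "real \<Rightarrow> nat \<Rightarrow> nat \<Rightarrow> real" where
  "Q_value q n \<mu> = (if \<mu> = 0 then 1 else (q ^ \<mu> * (1 - q ^ n) - R_term q n \<mu>) / (1 - q))"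

text \<open>The Gaussian binomials exposed here are the coefficients of \<open>zeta_denom\<close>,
  which links the remainder to the generating functions.\<close>

lemma R_term_qbinom:
  assumes q: "0 < q" "q < 1"
  shows "R_term q n \<mu> = q ^ ((\<mu> - 1) div 2 + 1) * (\<Sum>j<n div 2.
     (q ^ \<mu> * (1 - q ^ n) - q ^ (2 * ((\<mu> - 1) div 2) + 2) * (1 - q ^ (2 * j + 1))) * q ^ (2 * j)
       * (odd_Pi j q * qbinom (q ^ 2) (j + (\<mu> - 1) div 2) j))"
proof -
  have q2: "0 < q ^ 2" "q ^ 2 < 1" using q by (simp_all add: power_less_one_iff)
  have nz: "Pi_q i (q ^ 2) \<noteq> 0" for i using Pi_q_pos[OF q2, of i] by simp
  have "Pi_q (2 * j) q * Pi_q (j + t) (q ^ 2) / ((Pi_q j (q ^ 2))\<^sup>2 * Pi_q t (q ^ 2))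
      = odd_Pi j q * qbinom (q ^ 2) (j + t) j" for j t
    using nz[of j] nz[of t] qbinom_Pi_q[of j "j + t" "q ^ 2", symmetric]
    by (simp add: Pi_q_double power2_eq_square)
  then show ?thesis
    unfolding R_term_def by (simp only: times_divide_eq_right[symmetric])
qed

text \<open>The \<open>q\<close>-binomial series for the inverse of
  \<open>(1 - y) (1 - y Q) ... (1 - y Q^j)\<close> with \<open>y = q^3 x^2\<close> and
  \<open>Q = q^2\<close>. Multiplied by the last factor, the candidate series \<open>H\<close>
  reproduces the previous one by the Pascal rule.\<close>

lemma zeta_denom_nth:
  "fps_nth (zeta_denom q (Suc j)) i = (if even i then qbinom (q ^ 2) (j + i div 2) j * q ^ (3 * (i div 2)) else 0)"
proof (induction j arbitrary: i)
  case 0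
  define d where "d = 1 - fps_const (q ^ 3) * (fps_X ^ 2 :: real fps)"
  define H where "H = Abs_fps (\<lambda>i. if even i then q ^ (3 * (i div 2)) else (0 :: real))"
  have HD: "H * d = 1"
  proof (rule fps_ext)
    fix i
    have "fps_nth (H * d) i = fps_nth H i - q ^ 3 * (if i < 2 then 0 else fps_nth H (i - 2))"
      by (simp add: d_def right_diff_distrib mult.left_commute[of H] fps_X_power_mult_right_nth)
    also have "\<dots> = fps_nth 1 i"
    proof (cases "i < 2")
      case True
      then show ?thesis by (auto simp: H_def less_2_cases_iff)
    next
      case False
      then obtain l where "i = Suc (Suc l)" by (metis add_2_eq_Suc le_Suc_ex not_less)
      then show ?thesis by (simp add: H_def power_add)
    qed
    finally show "fps_nth (H * d) i = fps_nth 1 i" .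
  qed
  then have "d \<noteq> 0" by auto
  have "zeta_denom q (Suc 0) * d = 1"
    using zeta_denom_step[of q 0] by (simp only: d_def zeta_denom.simps(1) fps_const_power) simp
  with HD \<open>d \<noteq> 0\<close> have "zeta_denom q (Suc 0) = H"
    using mult_right_cancel[of d "zeta_denom q (Suc 0)" H] by simp
  then show ?case by (simp only: H_def qbinom.simps(1) fps_nth_Abs_fps mult_1_left)
next
  case (Suc j)
  define d where "d = 1 - fps_const (q ^ (2 * j + 5)) * (fps_X ^ 2 :: real fps)"
  define H where "H = Abs_fps (\<lambda>i. if even i then qbinom (q ^ 2) (Suc j + i div 2) (Suc j) * q ^ (3 * (i div 2)) else 0)"
  have "H * d = zeta_denom q (Suc j)"
  proof (rule fps_ext)
    fix i
    have "fps_nth (H * d) i = fps_nth H i - q ^ (2 * j + 5) * (if i < 2 then 0 else fps_nth H (i - 2))"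
      by (simp add: d_def right_diff_distrib mult.left_commute[of H] fps_X_power_mult_right_nth)
    also have "\<dots> = fps_nth (zeta_denom q (Suc j)) i"
    proof (cases "i < 2")
      case True
      have "qbinom (q ^ 2) j (Suc j) = 0" "qbinom (q ^ 2) j j = 1"
        by (simp_all add: qbinom_eq_0) (induction j, simp_all add: qbinom_eq_0)
      with True show ?thesis unfolding Suc by (auto simp: H_def less_2_cases_iff)
    next
      case False
      then obtain l where l: "i = Suc (Suc l)" by (metis add_2_eq_Suc le_Suc_ex not_less)
      have e: "q ^ (2 * j + 5) = (q ^ 2) ^ Suc j * q ^ 3"
        unfolding power_mult[symmetric] power_add[symmetric] by (simp add: add.commute)
      show ?thesis unfolding Suc l e by (simp add: H_def power_add algebra_simps)
    qed
    finally show "fps_nth (H * d) i = fps_nth (zeta_denom q (Suc j)) i" .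
  qed
  moreover have "zeta_denom q (Suc (Suc j)) * d = zeta_denom q (Suc j)"
    using zeta_denom_step[of q "Suc j"] by (simp add: d_def eval_nat_numeral)
  moreover have "d \<noteq> 0"
  proof
    assume "d = 0"
    then have "fps_nth d 0 = 0" by simp
    then show False by (simp add: d_def)
  qed
  ultimately have "zeta_denom q (Suc (Suc j)) = H"
    using mult_right_cancel[of d "zeta_denom q (Suc (Suc j))" H] by simp
  then show ?case by (simp add: H_def)
qed


text \<open>After multiplication by the factor outside the sum, each summand is a difference of
  consecutive values, of \<open>odd_Pi j c * zeta_denom q j\<close> in the first sum and of
  \<open>1 - c ^ (2 * j + 1)\<close> times it in the second.\<close>

lemma sum_zeta_terms:
  fixes q :: real
  defines "c \<equiv> fps_const q"
  shows "(\<Sum>j<k. c ^ (2 * j) * odd_Pi j c * zeta_denom q (Suc j)) * (c * (1 - c ^ 2 * fps_X ^ 2))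
      = 1 - odd_Pi k c * zeta_denom q k" (is "?s1 k * ?a = _")
    and "(\<Sum>j<k. (1 - c ^ (2 * j + 1)) * (c ^ (2 * j) * odd_Pi j c * zeta_denom q (Suc j))) * (c ^ 3 * (1 - fps_X ^ 2))
      = (1 - c) - (1 - c ^ (2 * k + 1)) * (odd_Pi k c * zeta_denom q k)" (is "?s2 k * ?b = _")
proof -
  define V where "V = zeta_denom q"
  have V: "V k = V (Suc k) * (1 - c ^ 3 * c ^ (2 * k) * fps_X ^ 2)" for k
    using zeta_denom_step[of q k] unfolding V_def c_def by (simp only: power_add mult_ac)
  have o: "odd_Pi (Suc k) c = (1 - c * c ^ (2 * k)) * odd_Pi k c" for k
    by (simp add: odd_Pi_Suc)
  have "(\<Sum>j<k. c ^ (2 * j) * odd_Pi j c * V (Suc j)) * (c * (1 - c ^ 2 * fps_X ^ 2))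
      = 1 - odd_Pi k c * V k"
  proof (induction k)
    case (Suc k)
    have "c ^ (2 * k) * odd_Pi k c * V (Suc k) * (c * (1 - c ^ 2 * fps_X ^ 2))
        = odd_Pi k c * V k - odd_Pi (Suc k) c * V (Suc k)"
      unfolding V[of k] o by (simp add: algebra_simps power2_eq_square power3_eq_cube)
    then show ?case using Suc by (simp only: sum.lessThan_Suc distrib_right) simp
  qed (simp add: V_def)
  then show "?s1 k * ?a = 1 - odd_Pi k c * zeta_denom q k" by (simp only: V_def)
  have "(\<Sum>j<k. (1 - c ^ (2 * j + 1)) * (c ^ (2 * j) * odd_Pi j c * V (Suc j))) * (c ^ 3 * (1 - fps_X ^ 2))
      = (1 - c) - (1 - c ^ (2 * k + 1)) * (odd_Pi k c * V k)"
  proof (induction k)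
    case (Suc k)
    have e: "c ^ (2 * k + 1) = c * c ^ (2 * k)" "c ^ (2 * Suc k + 1) = c ^ 3 * c ^ (2 * k)"
      by (simp_all add: power3_eq_cube mult_ac)
    have "(1 - c ^ (2 * k + 1)) * (c ^ (2 * k) * odd_Pi k c * V (Suc k)) * (c ^ 3 * (1 - fps_X ^ 2))
        = (1 - c ^ (2 * k + 1)) * (odd_Pi k c * V k)
          - (1 - c ^ (2 * Suc k + 1)) * (odd_Pi (Suc k) c * V (Suc k))"
      unfolding V[of k] o e by (simp add: algebra_simps)
    then show ?case using Suc by (simp only: sum.lessThan_Suc distrib_right) simp
  qed (simp add: V_def)
  then show "?s2 k * ?b = (1 - c) - (1 - c ^ (2 * k + 1)) * (odd_Pi k c * zeta_denom q k)"
    by (simp only: V_def)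
qed

text \<open>The generating function of \<open>R_term q n \<mu>\<close> over
  \<open>\<mu> \<ge> 1\<close>. The exponents \<open>2s + 1\<close> and \<open>2s + 2\<close> share
  the same \<open>s\<close>: passing from one to the other multiplies \<open>q^\<mu>\<close> by
  \<open>q\<close> and leaves \<open>q^(2s+2)\<close> alone, whence \<open>1 + q x\<close> and
  \<open>1 + x\<close>.\<close>

definition R_series :: "real \<Rightarrow> nat \<Rightarrow> real fps" where
  "R_series q n = (\<Sum>j<n div 2.
     (fps_const (q ^ 2 * (1 - q ^ n)) * fps_X * (1 + fps_const q * fps_X)
      - fps_const (q ^ 3 * (1 - q ^ (2 * j + 1))) * fps_X * (1 + fps_X))
     * (fps_const (q ^ (2 * j) * odd_Pi j q) * zeta_denom q (Suc j)))"

lemma R_series_0: "fps_nth (R_series q n) 0 = 0"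
  by (simp add: R_series_def fps_sum_nth fps_mult_nth_0)

lemma R_series_Suc:
  assumes q: "0 < q" "q < 1"
  shows "fps_nth (R_series q n) (Suc i) = R_term q n (Suc i)"
proof -
  define t where "t = i div 2"
  have nth: "fps_nth ((fps_const a * fps_X * (1 + fps_const q * fps_X) - fps_const b * fps_X * (1 + fps_X))
      * (fps_const d * f)) (Suc i) = d * ((a - b) * fps_nth f i + (a * q - b) * (if i = 0 then 0 else fps_nth f (i - 1)))"
    for a b d :: real and f
  proof -
    have "(fps_const a * fps_X * (1 + fps_const q * fps_X) - fps_const b * fps_X * (1 + fps_X)) * (fps_const d * f)
        = fps_const (d * (a - b)) * (fps_X * f) + fps_const (d * (a * q - b)) * (fps_X * (fps_X * f))"
      by (simp add: algebra_simps flip: fps_const_mult fps_const_sub)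
    then show ?thesis by (cases i) (simp_all add: algebra_simps)
  qed
  have dist: "q ^ (t + 1) * ((q ^ Suc i * u - q ^ (2 * t + 2) * v) * w * y)
      = (q ^ (t + 1) * q ^ Suc i * u - q ^ (t + 1) * q ^ (2 * t + 2) * v) * w * y" for u v w y
    by (simp only: right_diff_distrib left_diff_distrib mult_ac)
  \<comment> \<open>Since \<open>zeta_denom\<close> is a series in \<open>x^2\<close>, only the
    coefficient at \<open>i\<close> or the one at \<open>i - 1\<close> contributes, according to the
    parity of \<open>i\<close>.\<close>
  have "q ^ (2 * j) * odd_Pi j q * ((q ^ 2 * (1 - q ^ n) - q ^ 3 * (1 - q ^ (2 * j + 1))) * fps_nth (zeta_denom q (Suc j)) i
      + (q ^ 2 * (1 - q ^ n) * q - q ^ 3 * (1 - q ^ (2 * j + 1))) * (if i = 0 then 0 else fps_nth (zeta_denom q (Suc j)) (i - 1)))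
    = q ^ (t + 1) * ((q ^ Suc i * (1 - q ^ n) - q ^ (2 * t + 2) * (1 - q ^ (2 * j + 1))) * q ^ (2 * j)
       * (odd_Pi j q * qbinom (q ^ 2) (j + t) j))" for j
  proof (cases "even i")
    case True
    then have i: "i = 2 * t" by (simp add: t_def)
    have z: "fps_nth (zeta_denom q (Suc j)) i = qbinom (q ^ 2) (j + t) j * q ^ (3 * t)"
      unfolding zeta_denom_nth i by simp
    have z': "(if i = 0 then 0 else fps_nth (zeta_denom q (Suc j)) (i - 1)) = 0"
      using True unfolding zeta_denom_nth by auto
    have pw: "q ^ (t + 1) * q ^ Suc i = q ^ 2 * q ^ (3 * t)" "q ^ (t + 1) * q ^ (2 * t + 2) = q ^ 3 * q ^ (3 * t)"
      unfolding power_add[symmetric] i by (rule arg_cong[where f = "\<lambda>m. q ^ m"], simp)+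
    show ?thesis unfolding z z' dist pw by (simp only: algebra_simps mult_zero_right add_0_right)
  next
    case False
    then have i: "i = 2 * t + 1" using odd_two_times_div_two_succ[of i] by (simp add: t_def)
    have z: "fps_nth (zeta_denom q (Suc j)) i = 0"
      unfolding zeta_denom_nth i by simp
    have z': "(if i = 0 then 0 else fps_nth (zeta_denom q (Suc j)) (i - 1)) = qbinom (q ^ 2) (j + t) j * q ^ (3 * t)"
      unfolding zeta_denom_nth i by simp
    have pw: "q ^ (t + 1) * q ^ Suc i = q ^ 3 * q ^ (3 * t)" "q ^ (t + 1) * q ^ (2 * t + 2) = q ^ 3 * q ^ (3 * t)"
      unfolding power_add[symmetric] i by (rule arg_cong[where f = "\<lambda>m. q ^ m"], simp)+
    show ?thesis
      unfolding z z' dist pw by (simp add: algebra_simps power2_eq_square power3_eq_cube)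
  qed
  then show ?thesis
    unfolding R_term_qbinom[OF q] R_series_def fps_sum_nth nth
    by (simp only: diff_Suc_1 t_def sum_distrib_left)
qed


text \<open>The multiplier completes \<open>1 + q x\<close> and \<open>1 + x\<close> to
  \<open>1 - q^2 x^2\<close> and \<open>1 - x^2\<close>, the factors under which the two sums of
  \<open>sum_zeta_terms\<close> telescope.\<close>

lemma R_series_eq:
  fixes q :: real and n :: nat
  defines "c \<equiv> fps_const q" and "k \<equiv> n div 2"
  defines "U \<equiv> odd_Pi k c * zeta_denom q k"
  shows "R_series q n * ((1 - c * fps_X) * (1 - fps_X))
    = (1 - fps_X) * fps_X * (1 - c ^ n) * c * (1 - U)
      - (1 - c * fps_X) * fps_X * ((1 - c) - (1 - c ^ (2 * k + 1)) * U)"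
proof -
  define s1 where "s1 = (\<Sum>j<k. c ^ (2 * j) * odd_Pi j c * zeta_denom q (Suc j))"
  define s2 where "s2 = (\<Sum>j<k. (1 - c ^ (2 * j + 1)) * (c ^ (2 * j) * odd_Pi j c * zeta_denom q (Suc j)))"
  have s1: "s1 * (c * (1 - c ^ 2 * fps_X ^ 2)) = 1 - U"
    unfolding s1_def U_def c_def by (rule sum_zeta_terms)
  have s2: "s2 * (c ^ 3 * (1 - fps_X ^ 2)) = (1 - c) - (1 - c ^ (2 * k + 1)) * U"
    unfolding s2_def U_def c_def by (rule sum_zeta_terms)
  have "R_series q n = (\<Sum>j<k.
     (c ^ 2 * (1 - c ^ n) * fps_X * (1 + c * fps_X) - c ^ 3 * (1 - c ^ (2 * j + 1)) * fps_X * (1 + fps_X))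
     * (c ^ (2 * j) * odd_Pi j c * zeta_denom q (Suc j)))"
  proof -
    have "fps_const (1 - q ^ m) = 1 - c ^ m" for m by (simp add: c_def)
    moreover have "fps_const (q ^ m) = c ^ m" for m by (simp add: c_def)
    moreover have "fps_const (odd_Pi m q) = odd_Pi m c" for m by (simp add: c_def odd_Pi_fps_const)
    ultimately show ?thesis
      unfolding R_series_def fps_const_mult[symmetric] k_def c_def[symmetric] by (simp only:)
  qed
  also have "\<dots> = c ^ 2 * (1 - c ^ n) * fps_X * (1 + c * fps_X) * s1 - c ^ 3 * fps_X * (1 + fps_X) * s2"
    unfolding s1_def s2_def sum_distrib_left sum_subtractf[symmetric]
    by (intro sum.cong refl) (simp add: algebra_simps)
  finally have R: "R_series q n = c ^ 2 * (1 - c ^ n) * fps_X * (1 + c * fps_X) * s1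
      - c ^ 3 * fps_X * (1 + fps_X) * s2" .
  define x where "x = (fps_X :: real fps)"
  have "R_series q n * ((1 - c * x) * (1 - x))
    = (1 - x) * x * (1 - c ^ n) * c * (s1 * (c * (1 - c ^ 2 * x ^ 2)))
      - (1 - c * x) * x * (s2 * (c ^ 3 * (1 - x ^ 2)))"
    unfolding R x_def[symmetric] by (simp add: algebra_simps power2_eq_square power3_eq_cube)
  then show ?thesis unfolding x_def s1 s2 .
qed

text \<open>The generating function of the \<open>p\<close>-adic valuation of the determinant of a random symmetric
  matrix over the \<open>p\<close>-adic integers; the second factor is \<open>1 / (1 - q x)\<close>.\<close>
definition zeta_series :: "real \<Rightarrow> nat \<Rightarrow> real fps" where
  "zeta_series q n = zeta_num q n * Abs_fps (\<lambda>i. q ^ i)"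

text \<open>This is the usual relation between tail probabilities and point probabilities: the
  claimed values are the tails of the distribution generated by
  \<open>zeta_series q n\<close>.\<close>

lemma Q_series_eq:
  assumes q: "0 < q" "q < 1"
  shows "(1 - fps_X) * Abs_fps (Q_value q n) = 1 - fps_X * zeta_series q n"
proof -
  define c where "c = fps_const q"
  define k where "k = n div 2"
  define x where "x = (fps_X :: real fps)"
  define U where "U = odd_Pi k c * zeta_denom q k"
  define T where "T = Abs_fps (\<lambda>i. q ^ i)"
  define W where "W = Abs_fps (Q_value q n)"
  define D where "D = 1 - c * x"
  define M where "M = (if even n then 1 - c ^ (n + 1) * x else 1 - c ^ n)"
  have T: "T * D = 1"
  proof (rule fps_ext)
    fix i
    have "T * D = T - c * (T * x)" by (simp add: D_def algebra_simps)
    then show "fps_nth (T * D) i = fps_nth 1 i"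
      by (cases i) (simp_all add: c_def x_def T_def)
  qed
  have n: "n = 2 * k" if "even n" using that by (simp add: k_def)
  have n': "n = 2 * k + 1" if "odd n" using odd_two_times_div_two_succ[OF that] by (simp add: k_def)
  have zn: "zeta_num q n = M * U"
  proof (cases "even n")
    case True
    have "(n + 1) div 2 = k" "n div 2 = k" using n[OF True] by simp_all
    with True show ?thesis by (simp only: zeta_num_def M_def U_def c_def x_def if_True mult_ac)
  next
    case False
    have "(n + 1) div 2 = Suc k" "n div 2 = k" using n'[OF False] by simp_all
    then show ?thesis
      using False n'[OF False] by (simp only: zeta_num_def M_def U_def c_def odd_Pi_Suc if_False mult_1_left mult_1_right mult_ac)
  qed
  have W: "(1 - c) * (W - 1) = (1 - c ^ n) * c * x * T - R_series q n"
  proof (rule fps_ext)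
    fix i
    have c': "(1 - c) = fps_const (1 - q)" "(1 - c ^ n) * c = fps_const ((1 - q ^ n) * q)"
      by (simp_all add: c_def)
    show "fps_nth ((1 - c) * (W - 1)) i = fps_nth ((1 - c ^ n) * c * x * T - R_series q n) i"
    proof (cases i)
      case 0
      then show ?thesis
        unfolding c' by (simp add: W_def Q_value_def x_def R_series_0 mult.assoc)
    next
      case (Suc l)
      then show ?thesis
        unfolding c' using q by (simp add: W_def Q_value_def x_def T_def R_series_Suc mult.assoc)
    qed
  qed
  \<comment> \<open>The parts of the two telescoped sums that contain \<open>U\<close> recombine,
    for either parity of \<open>n\<close>, to the numerator
    \<open>zeta_num q n = M * U\<close>.\<close>
  have M: "(1 - x) * (1 - c ^ n) * c * U - D * (1 - c ^ (2 * k + 1)) * U = - (1 - c) * (M * U)"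
  proof (cases "even n")
    case True
    show ?thesis
      unfolding M_def D_def if_P[OF True] n[OF True, symmetric] by (simp add: algebra_simps)
  next
    case False
    show ?thesis
      unfolding M_def D_def if_not_P[OF False] n'[OF False, symmetric] by (simp add: algebra_simps)
  qed
  have "(1 - c) * D * ((1 - x) * W)
      = (1 - c) * D * (1 - x) + D * (1 - x) * ((1 - c) * (W - 1))"
    by (simp add: algebra_simps)
  also have "\<dots> = (1 - c) * D * (1 - x) + (1 - x) * (1 - c ^ n) * c * x * (T * D) - R_series q n * (D * (1 - x))"
    unfolding W by (simp add: algebra_simps)
  also have "\<dots> = (1 - c) * D * (1 - x) + (1 - x) * (1 - c ^ n) * c * x
      - ((1 - x) * x * (1 - c ^ n) * c * (1 - U) - D * x * ((1 - c) - (1 - c ^ (2 * k + 1)) * U))"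
    using R_series_eq[of q n, folded c_def k_def x_def, folded U_def D_def] by (simp add: T)
  also have "\<dots> = (1 - c) * D + x * ((1 - x) * (1 - c ^ n) * c * U - D * (1 - c ^ (2 * k + 1)) * U)"
    by (simp add: algebra_simps)
  also have "\<dots> = (1 - c) * D * (1 - x * (zeta_num q n * T))"
  proof -
    have "(1 - c) * D * (1 - x * (M * U * T)) = (1 - c) * D - (1 - c) * x * (M * U) * (T * D)"
      by (simp add: algebra_simps)
    then show ?thesis unfolding M zn T by (simp add: algebra_simps)
  qed
  finally have eq: "(1 - c) * D * ((1 - x) * W) = (1 - c) * D * (1 - x * (zeta_num q n * T))" .
  have "fps_nth ((1 - c) * D) 0 = 1 - q" by (simp add: fps_mult_nth_0 c_def D_def x_def)
  then have "(1 - c) * D \<noteq> 0" using q by auto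
  then show ?thesis
    using eq by (simp add: W_def x_def T_def zeta_series_def)
qed


lemma zeta_series_fixed_point:
  assumes q: "0 < q" "q < 1"
  shows "(\<Sum>r\<le>n. fps_const (corank_prob q n r) * (fps_X ^ r * zeta_series q r)) = zeta_series q n"
  unfolding zeta_series_def zeta_num_fixed_point[OF q, of n, symmetric] sum_distrib_right
  by (simp add: mult.assoc)

text \<open>After multiplication by \<open>1 - x\<close> this is the fixed point equation for
  \<open>zeta_series\<close>: lowering the exponent by \<open>r\<close> multiplies the series by
  \<open>x^r\<close>, and the constants agree because the corank weights sum to 1.\<close>

lemma corank_mean_Q_value:
  assumes q: "0 < q" "q < 1"
  shows "corank_mean q n (\<lambda>r. Q_value q r (\<mu> - r)) = Q_value q n \<mu>"
proof -
  define x where "x = (fps_X :: real fps)"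
  have x: "1 - x \<noteq> 0"
  proof
    assume "1 - x = 0"
    then have "fps_nth (1 - x) 0 = 0" by simp
    then show False by (simp add: x_def)
  qed
  \<comment> \<open>The coefficients below \<open>x^r\<close> are all 1 by the convention at
    exponent 0; they form the geometric sum.\<close>
  have shift: "(1 - x) * Abs_fps (\<lambda>\<mu>. Q_value q r (\<mu> - r)) = 1 - x * (x ^ r * zeta_series q r)" for r
  proof -
    have "Abs_fps (\<lambda>\<mu>. Q_value q r (\<mu> - r)) = x ^ r * Abs_fps (Q_value q r) + (\<Sum>i<r. x ^ i)"
      by (rule fps_ext) (auto simp: x_def fps_X_power_mult_nth fps_sum_nth fps_X_power_nth Q_value_def)
    then have "(1 - x) * Abs_fps (\<lambda>\<mu>. Q_value q r (\<mu> - r))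
        = x ^ r * ((1 - x) * Abs_fps (Q_value q r)) + (1 - x) * (\<Sum>i<r. x ^ i)"
      by (simp add: algebra_simps)
    also have "(1 - x) * (\<Sum>i<r. x ^ i) = 1 - x ^ r" by (rule one_diff_power_eq[symmetric])
    finally show ?thesis
      unfolding Q_series_eq[OF q, of r, folded x_def] by (simp add: algebra_simps)
  qed
  have one: "(\<Sum>r\<le>n. fps_const (corank_prob q n r)) = 1"
    using corank_mean_const[OF q, of n 1]
    by (intro fps_ext) (simp add: fps_sum_nth corank_mean_def)
  have "(1 - x) * (\<Sum>r\<le>n. fps_const (corank_prob q n r) * Abs_fps (\<lambda>\<mu>. Q_value q r (\<mu> - r)))
      = (\<Sum>r\<le>n. fps_const (corank_prob q n r) * (1 - x * (x ^ r * zeta_series q r)))"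
    unfolding sum_distrib_left shift[symmetric] by (simp add: mult.left_commute)
  also have "\<dots> = 1 - x * (\<Sum>r\<le>n. fps_const (corank_prob q n r) * (x ^ r * zeta_series q r))"
    by (simp add: right_diff_distrib sum_subtractf one sum_distrib_left mult.left_commute)
  also have "\<dots> = (1 - x) * Abs_fps (Q_value q n)"
    using Q_series_eq[OF q, of n] zeta_series_fixed_point[OF q, of n] by (simp add: x_def)
  finally have "(\<Sum>r\<le>n. fps_const (corank_prob q n r) * Abs_fps (\<lambda>\<mu>. Q_value q r (\<mu> - r))) = Abs_fps (Q_value q n)"
    using x by simp
  then have "fps_nth (\<Sum>r\<le>n. fps_const (corank_prob q n r) * Abs_fps (\<lambda>\<mu>. Q_value q r (\<mu> - r))) \<mu>
      = Q_value q n \<mu>" by simp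
  then show ?thesis by (simp add: fps_sum_nth corank_mean_def)
qed

section \<open>Bounds on the remainder\<close>

text \<open>Factor by factor, \<open>odd_Pi j q\<close> is at most \<open>Pi_q j (q ^ 2)\<close>,
  which cancels the same product in the denominator of the Gaussian binomial. The remaining quotient
  \<open>Pi_q (j + t) (q ^ 2) / Pi_q t (q ^ 2)\<close> is a product of factors below 1.\<close>

lemma R_term_weight_bounds:
  fixes q :: real
  assumes q: "0 < q" "q < 1"
  shows "0 \<le> odd_Pi j q * qbinom (q ^ 2) (j + t) j" "odd_Pi j q * qbinom (q ^ 2) (j + t) j \<le> 1"
proof -
  have q2: "0 < q ^ 2" "q ^ 2 < 1" using q by (simp_all add: power_less_one_iff)
  have o: "0 \<le> odd_Pi j q \<and> odd_Pi j q \<le> Pi_q j (q ^ 2)"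
  proof (induction j)
    case (Suc j)
    have "q ^ (2 * j + 2) \<le> q ^ (2 * j + 1)"
      by (rule power_decreasing) (use q in simp_all)
    moreover have "q ^ (2 * j + 1) \<le> 1"
      by (rule power_le_one) (use q in simp_all)
    moreover have "(q ^ 2) ^ Suc j = q ^ (2 * j + 2)" unfolding power_mult[symmetric] by simp
    ultimately show ?case
      unfolding odd_Pi_Suc Pi_q_Suc using Suc by (intro conjI mult_mono mult_nonneg_nonneg) auto
  qed simp
  have P: "0 < Pi_q i (q ^ 2)" for i by (rule Pi_q_pos[OF q2])
  have le: "Pi_q (j + t) (q ^ 2) \<le> Pi_q t (q ^ 2)"
  proof (induction j)
    case (Suc j)
    have "Pi_q (Suc (j + t)) (q ^ 2) \<le> 1 * Pi_q (j + t) (q ^ 2)"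
      unfolding Pi_q_Suc using P[of "j + t"] q2 by (intro mult_right_mono) auto
    with Suc show ?case by simp
  qed simp
  have e: "qbinom (q ^ 2) (j + t) j * (Pi_q j (q ^ 2) * Pi_q t (q ^ 2)) = Pi_q (j + t) (q ^ 2)"
    using qbinom_Pi_q[of j "j + t" "q ^ 2"] by simp
  then have b: "qbinom (q ^ 2) (j + t) j = Pi_q (j + t) (q ^ 2) / (Pi_q j (q ^ 2) * Pi_q t (q ^ 2))"
    using P[of j] P[of t] by (simp add: nonzero_eq_divide_eq)
  then have b0: "0 \<le> qbinom (q ^ 2) (j + t) j" using P by (simp add: less_imp_le)
  then show "0 \<le> odd_Pi j q * qbinom (q ^ 2) (j + t) j" using o by simp
  have "odd_Pi j q * qbinom (q ^ 2) (j + t) j \<le> Pi_q j (q ^ 2) * qbinom (q ^ 2) (j + t) j"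
    using o b0 by (intro mult_right_mono) auto
  also have "\<dots> = Pi_q (j + t) (q ^ 2) / Pi_q t (q ^ 2)"
    using P[of j] by (simp add: b)
  also have "\<dots> \<le> 1" using le P[of t] by simp
  finally show "odd_Pi j q * qbinom (q ^ 2) (j + t) j \<le> 1" .
qed

text \<open>Each bracket lies between 0 and \<open>q^\<mu> (1 - q^2)\<close>, so the sum is
  dominated by a telescoping geometric sum below \<open>q^\<mu>\<close>. The prefactor
  \<open>q^(t+1)\<close> suffices because \<open>t + 1 \<ge> \<mu> / 2\<close>.\<close>

lemma R_term_bounds:
  assumes q: "0 < q" "q \<le> 1 / 2" and "\<mu> > 0"
  shows "0 \<le> R_term q n \<mu>" "R_term q n \<mu> < q powr (3 * real \<mu> / 2)"
proof -
  define t where "t = (\<mu> - 1) div 2"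
  define k where "k = n div 2"
  define d where "d = (\<lambda>j. q ^ \<mu> * (1 - q ^ n) - q ^ (2 * t + 2) * (1 - q ^ (2 * j + 1)))"
  define w where "w = (\<lambda>j. odd_Pi j q * qbinom (q ^ 2) (j + t) j)"
  have q1: "q < 1" using q by simp
  have R: "R_term q n \<mu> = q ^ (t + 1) * (\<Sum>j<k. d j * q ^ (2 * j) * w j)"
    using R_term_qbinom[OF q(1) q1] by (simp add: d_def w_def t_def k_def)
  have w: "0 \<le> w j" "w j \<le> 1" for j
    unfolding w_def using R_term_weight_bounds[OF q(1) q1] by auto
  \<comment> \<open>For odd \<open>\<mu>\<close> the upper bound on the bracket comes down to
    \<open>1 - q + q^2 \<le> 1 - q^2\<close>, which is this inequality.\<close>
  have qq: "q ^ 2 \<le> q / 2" using mult_left_mono[OF q(2), of q] q by (simp add: power2_eq_square)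
  have d: "0 \<le> d j \<and> d j \<le> q ^ \<mu> * (1 - q ^ 2)" if "j < k" for j
  proof -
    have anti: "q ^ b \<le> q ^ a" if "a \<le> b" for a b
      by (rule power_decreasing) (use that q q1 in simp_all)
    have "2 * j + 2 \<le> n" using that by (simp add: k_def)
    then have "q ^ n \<le> q ^ (2 * j + 2)" by (rule anti)
    moreover have "q ^ (2 * j + 2) \<le> q ^ 2" "q ^ (2 * j + 2) \<le> q ^ (2 * j + 1)"
      "q ^ (2 * j + 1) \<le> q ^ 1"
      by (rule anti; simp)+
    moreover have "0 \<le> q ^ n" using q by simp
    ultimately have le: "q ^ n \<le> q ^ (2 * j + 2)" "q ^ (2 * j + 2) \<le> q ^ 2" "0 \<le> q ^ n"
      "q ^ (2 * j + 2) \<le> q ^ (2 * j + 1)" "q ^ (2 * j + 1) \<le> q" by simp_all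
    show ?thesis
    proof (cases "odd \<mu>")
      case True
      then have "2 * t + 2 = \<mu> + 1" using assms(3) unfolding t_def by (elim oddE) simp
      then have "d j = q ^ \<mu> * (1 - q ^ n - q + q ^ (2 * j + 2))"
        by (simp add: d_def algebra_simps power_add)
      moreover have "0 \<le> 1 - q ^ n - q + q ^ (2 * j + 2)" using le(1) q1 by linarith
      moreover have "1 - q ^ n - q + q ^ (2 * j + 2) \<le> 1 - q ^ 2" using le(2,3) qq by linarith
      ultimately show ?thesis using q by (simp only: mult_left_mono mult_nonneg_nonneg zero_le_power less_imp_le)
    next
      case False
      then obtain b where "\<mu> = 2 * b" by auto
      then have "2 * t + 2 = \<mu>" using assms(3) unfolding t_def by (cases b) simp_all
      then have "d j = q ^ \<mu> * (q ^ (2 * j + 1) - q ^ n)"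
        by (simp add: d_def algebra_simps)
      moreover have "0 \<le> q ^ (2 * j + 1) - q ^ n" using le(1,4) by linarith
      moreover have "q ^ (2 * j + 1) - q ^ n \<le> 1 - q ^ 2" using le(3,5) qq q by linarith
      ultimately show ?thesis using q by (simp only: mult_left_mono mult_nonneg_nonneg zero_le_power less_imp_le)
    qed
  qed
  show "0 \<le> R_term q n \<mu>"
    unfolding R using q d w by (intro mult_nonneg_nonneg sum_nonneg) auto
  have "d j * q ^ (2 * j) * w j \<le> q ^ \<mu> * (q ^ (2 * j) - q ^ (2 * Suc j))" if "j < k" for j
  proof -
    have "d j * q ^ (2 * j) * w j \<le> d j * q ^ (2 * j) * 1"
      using d[OF that] w q by (intro mult_left_mono) auto
    also have "\<dots> \<le> q ^ \<mu> * (1 - q ^ 2) * q ^ (2 * j)"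
      using d[OF that] q by (simp add: mult_right_mono)
    finally show ?thesis by (simp add: algebra_simps power2_eq_square)
  qed
  then have "(\<Sum>j<k. d j * q ^ (2 * j) * w j) \<le> (\<Sum>j<k. q ^ \<mu> * (q ^ (2 * j) - q ^ (2 * Suc j)))"
    by (intro sum_mono) simp
  also have "\<dots> = q ^ \<mu> * (1 - q ^ (2 * k))"
    unfolding sum_distrib_left[symmetric] sum_lessThan_telescope'[of "\<lambda>j. q ^ (2 * j)"] by simp
  also have "\<dots> < q ^ \<mu> * 1"
    using q by (intro mult_strict_left_mono) auto
  finally have "R_term q n \<mu> < q ^ (t + 1) * q ^ \<mu>"
    unfolding R using q by (intro mult_strict_left_mono) auto
  also have "\<dots> = q powr (real (t + 1 + \<mu>))"
    by (simp only: powr_realpow[OF q(1)] power_add)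
  also have "\<dots> \<le> q powr (3 * real \<mu> / 2)"
  proof (rule powr_mono')
    have "\<mu> \<le> 2 * t + 2" unfolding t_def by linarith
    then show "3 * real \<mu> / 2 \<le> real (t + 1 + \<mu>)" by simp
  qed (use q q1 in auto)
  finally show "R_term q n \<mu> < q powr (3 * real \<mu> / 2)" .
qed

section \<open>The probability of a vanishing determinant\<close>

lemma Q_prob_eq_res_mats:
  "Q_prob n (p ^ \<mu>) = real (card (singular_mats p \<mu> \<mu> {} {0..<n})) / real (card (res_mats p \<mu> {} {0..<n}))"
proof -
  have "sym_mats n (p ^ \<mu>) = res_mats p \<mu> {} {0..<n}"
    by (auto simp: sym_mats_def res_mats_def residue_entries_def)
  then show ?thesis
    by (simp add: Q_prob_def singular_mats_def det_n_eq_det_on)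
qed

lemma card_res_mats_pos:
  assumes "p > 0" "finite I"
  shows "card (res_mats p L S I) > 0"
proof -
  have "(\<lambda>_ _. 0) \<in> res_mats p L S I"
    using assms(1) by (simp add: res_mats_def residue_entries_def)
  then show ?thesis using assms(2) by (auto simp: card_gt_0_iff)
qed

text \<open>The step rule for \<open>G\<close> comes from \<open>corank_mean_rec\<close>, and its
  scaling rule from the fixed point equation \<open>corank_mean_Q_value\<close>.\<close>

lemma Q_prob_prime_power:
  assumes p: "prime p"
  shows "Q_prob n (p ^ \<mu>) = Q_value (1 / real p) n \<mu>"
proof -
  define q where "q = 1 / real p"
  have q: "0 < q" "q < 1" using prime_gt_1_nat[OF p] by (simp_all add: q_def)
  \<comment> \<open>If the block of the other \<open>m\<close> rows has corank \<open>j\<close>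
    modulo \<open>p\<close>, elimination leaves \<open>r + j\<close> rows divisible by
    \<open>p\<close>; dividing by \<open>p\<close> then lowers the exponent by
    \<open>r + j\<close>.\<close>
  define G where "G = (\<lambda>r m \<mu>. corank_mean q m (\<lambda>j. Q_value q (r + j) (\<mu> - (r + j))))"
  have diag: "G 0 m \<mu> = Q_value q m \<mu>" for m \<mu>
    using corank_mean_Q_value[OF q] by (simp add: G_def)
  have "real (card (singular_mats p \<mu> \<mu> {} {0..<n}))
      = G (card ({} :: nat set)) (card ({0..<n} - {})) \<mu> * card (res_mats p \<mu> {} {0..<n})"
  proof (rule singular_mats_probability[OF p])
    show "G r m 0 = 1" for r m
      using corank_mean_const[OF q, of m 1] by (simp add: G_def Q_value_def)
    show "G 0 0 \<mu> = 0" if "\<mu> > 0" for \<mu>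
      unfolding diag using that by (simp add: Q_value_def R_term_def)
    show "G r 0 \<mu> = G 0 r (\<mu> - r)" for r \<mu>
      unfolding diag by (simp add: G_def corank_mean_0)
    show "G r m \<mu> = (1 - 1 / real p) * G r (m - 1) \<mu>
        + 1 / real p * (1 - (1 / real p) ^ (m - 1)) * G r (m - 2) \<mu> + (1 / real p) ^ m * G (Suc r) (m - 1) \<mu>"
      if "m > 0" for r m \<mu>
      unfolding q_def[symmetric] G_def by (subst corank_mean_rec[OF q that]) simp
  qed auto
  then have sing: "real (card (singular_mats p \<mu> \<mu> {} {0..<n}))
      = Q_value q n \<mu> * card (res_mats p \<mu> {} {0..<n})"
    by (simp add: diag)
  have "card (res_mats p \<mu> {} {0..<n}) > 0"
    by (intro card_res_mats_pos prime_gt_0_nat p) simp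
  then have "real (card (res_mats p \<mu> {} {0..<n})) \<noteq> 0"
    by (simp only: of_nat_eq_0_iff neq0_conv)
  then show ?thesis
    unfolding Q_prob_eq_res_mats sing q_def[symmetric] by (rule nonzero_mult_div_cancel_right)
qed

theorem theorem5p2:
  fixes p n \<mu> :: nat
  assumes "prime p" and "n \<ge> 1" and "\<mu> \<ge> 1"
  defines "q \<equiv> 1 / real p"
    and "k \<equiv> n div 2"
    and "t \<equiv> (\<mu> - 1) div 2"
  defines "R \<equiv> q ^ (t + 1) * (\<Sum>j<k.
              (q ^ \<mu> * (1 - q ^ n) - q ^ (2*t + 2) * (1 - q ^ (2*j + 1))) * q ^ (2*j)
              * (Pi_q (2*j) q * Pi_q (j + t) (q^2)) / ((Pi_q j (q^2))^2 * Pi_q t (q^2)))"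
  shows "Q_prob n (p ^ \<mu>) = (q ^ \<mu> * (1 - q ^ n) - R) / (1 - q)
         \<and> 0 \<le> R \<and> R < q powr (3 * real \<mu> / 2)"
proof -
  have R: "R = R_term q n \<mu>" by (simp only: R_def R_term_def k_def t_def)
  have "2 \<le> real p" using prime_ge_2_nat[OF assms(1)] by simp
  then have q: "0 < q" "q \<le> 1 / 2" by (simp_all add: q_def field_simps)
  have "Q_prob n (p ^ \<mu>) = (q ^ \<mu> * (1 - q ^ n) - R) / (1 - q)"
    unfolding R using Q_prob_prime_power[OF assms(1), of n \<mu>, folded q_def] assms(3)
    by (simp add: Q_value_def)
  moreover have "0 \<le> R" "R < q powr (3 * real \<mu> / 2)"
    unfolding R using R_term_bounds[OF q, of \<mu> n] assms(3) by simp_all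
  ultimately show ?thesis by blast
qed

end
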